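(* Let $\Omega\subset\mathbb{R}^N$ be a domain, let $\mathscr{A}$ be an $N\times N$ matrix function on $\Omega$ with complex valued entries in $L^\infty(\Omega)$, let $\varphi:(0,+\infty)\to(0,+\infty)$ satisfy conditions (i)--(v) of the context, let $\Lambda$ be the associated function defined in the context, and let $Eu=\nabla(\mathscr{A}\nabla u)$. If $$[1-\Lambda^2(t)]\langle\operatorname{Re}\mathscr{A}(x)\xi,\xi\rangle+\langle\operatorname{Re}\mathscr{A}(x)\eta,\eta\rangle+[1+\Lambda(t)]\langle\operatorname{Im}\mathscr{A}(x)\xi,\eta\rangle+[1-\Lambda(t)]\langle\operatorname{Im}\mathscr{A}^*(x)\xi,\eta\rangle\geq0$$ for almost every $x\in\Omega$ and for any $t>0$, $\xi,\eta\in\mathbb{R}^N$, then the operator $E$ is $L^\Phi$-dissipative.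
   Context: Conditions on the positive function $\varphi$ on $(0,+\infty)$: (i) $\varphi\in C^1((0,+\infty))$; (ii) $(s\varphi(s))'>0$ for any $s>0$; (iii) the range of the strictly increasing function $s\mapsto s\varphi(s)$ is $(0,+\infty)$; (iv) there exist positive constants $C_1,C_2$, a real number $r>-1$ and $s_0>0$ such that $C_1 s^r\leq (s\varphi(s))'\leq C_2 s^r$ for $s\in(0,s_0)$; if $r=0$ it is moreover required that the finite limit $\lim_{s\to0^+}\varphi(s)=\varphi_+(0)>0$ exists and that $\lim_{s\to0^+}s\varphi'(s)=0$; (v) there exists $s_1>s_0$ such that either $\varphi'(s)\geq0$ for all $s\geq s_1$, or $\varphi'(s)\leq0$ for all $s\geq s_1$. The function $s\mapsto s\sqrt{\varphi(s)}$ is strictly increasing with range $(0,+\infty)$; let $\zeta(t)$ be its inverse, which is $C^1$ on $(0,+\infty)$. Define, for $t>0$, $\Theta(t)=\zeta(t)/t$ and $\Lambda(t)=t\,\Theta'(t)/\Theta(t)$. Notation: $\operatorname{Re}$ and $\operatorname{Im}$ of a matrix are the entrywise real and imaginary parts; $\mathscr{A}^*=\overline{\mathscr{A}}^{t}$ is the adjoint matrix (so $\operatorname{Im}\mathscr{A}^*$ is the entrywise imaginary part of $\mathscr{A}^*$). $\langle\cdot,\cdot\rangle$ is the standard inner product in $\mathbb{C}^N$ (conjugate linear in the second argument). $\mathring{H}^1(\Omega)$ is the closure of the complex valued functions in $C_0^\infty(\Omega)$ in the $H^1$ norm. The combination $\varphi(|u|)u$ is taken to be $0$ where $u$ vanishes.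 Definition: with $\Phi(s)=\int_0^s\sigma\varphi(\sigma)\,d\sigma$, the operator $E$ is called $L^\Phi$-dissipative if $$\operatorname{Re}\int_\Omega\langle\mathscr{A}\nabla u,\nabla(\varphi(|u|)\,u)\rangle\,dx\geq0$$ for any complex valued $u\in\mathring{H}^1(\Omega)$ such that $\varphi(|u|)\,u\in\mathring{H}^1(\Omega)$. *)

theory Defs
  imports "HOL-Analysis.Analysis"
begin

section \<open>The function \<open>\<phi>\<close> and the associated functions\<close>

text \<open>The bounds near \<open>0\<close> and the monotonicity at infinity share \<open>s0\<close>.\<close>

definition admissible :: "(real \<Rightarrow> real) \<Rightarrow> bool" where
  "admissible \<phi> \<longleftrightarrow>
     (\<forall>s>0. \<phi> s > 0) \<and>
     \<phi> C1_differentiable_on {0<..} \<and>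
     (\<forall>s>0. deriv (\<lambda>s. s * \<phi> s) s > 0) \<and>
     (\<lambda>s. s * \<phi> s) ` {0<..} = {0<..} \<and>
     (\<exists>C1 C2 r s0 s1. C1 > 0 \<and> C2 > 0 \<and> r > -1 \<and> s0 > 0 \<and>
        (\<forall>s\<in>{0<..<s0}. C1 * s powr r \<le> deriv (\<lambda>s. s * \<phi> s) s \<and>
                       deriv (\<lambda>s. s * \<phi> s) s \<le> C2 * s powr r) \<and>
        (r = 0 \<longrightarrow> (\<exists>l>0. (\<phi> \<longlongrightarrow> l) (at_right 0)) \<and>
                   ((\<lambda>s. s * deriv \<phi> s) \<longlongrightarrow> 0) (at_right 0)) \<and>
        s1 > s0 \<and>
        ((\<forall>s\<ge>s1. deriv \<phi> s \<ge> 0) \<or> (\<forall>s\<ge>s1. deriv \<phi> s \<le> 0)))"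

definition zeta :: "(real \<Rightarrow> real) \<Rightarrow> real \<Rightarrow> real" where
  "zeta \<phi> = the_inv_into {0<..} (\<lambda>s. s * sqrt (\<phi> s))"

definition Theta :: "(real \<Rightarrow> real) \<Rightarrow> real \<Rightarrow> real" where
  "Theta \<phi> t = zeta \<phi> t / t"

definition Lambda :: "(real \<Rightarrow> real) \<Rightarrow> real \<Rightarrow> real" where
  "Lambda \<phi> t = t * deriv (Theta \<phi>) t / Theta \<phi> t"


section \<open>Complex vectors and matrices\<close>

definition cinner :: "complex^'n \<Rightarrow> complex^'n \<Rightarrow> complex" where
  "cinner v w = (\<Sum>i\<in>UNIV. v $ i * cnj (w $ i))"

definition Re_mat :: "complex^'n^'m \<Rightarrow> real^'n^'m" where
  "Re_mat A = (\<chi> i j. Re (A $ i $ j))"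

definition Im_mat :: "complex^'n^'m \<Rightarrow> real^'n^'m" where
  "Im_mat A = (\<chi> i j. Im (A $ i $ j))"

definition adjoint_mat :: "complex^'n^'m \<Rightarrow> complex^'m^'n" where
  "adjoint_mat A = (\<chi> i j. cnj (A $ j $ i))"

definition Linf_matrix :: "(real^'n) set \<Rightarrow> (real^'n \<Rightarrow> complex^'n^'n) \<Rightarrow> bool" where
  "Linf_matrix \<Omega> A \<longleftrightarrow>
     (\<forall>i j. (\<lambda>x. A x $ i $ j) \<in> borel_measurable (lebesgue_on \<Omega>) \<and>
            (\<exists>C. AE x in lebesgue_on \<Omega>. cmod (A x $ i $ j) \<le> C))"


section \<open>Sobolev spaces of complex valued functions\<close>

definition partial_deriv :: "'n \<Rightarrow> (real^'n \<Rightarrow> complex) \<Rightarrow> real^'n \<Rightarrow> complex" where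
  "partial_deriv i f x = frechet_derivative f (at x) (axis i 1)"

primrec C_k :: "nat \<Rightarrow> (real^'n \<Rightarrow> complex) \<Rightarrow> bool" where
  "C_k 0 f \<longleftrightarrow> continuous_on UNIV f"
| "C_k (Suc k) f \<longleftrightarrow> f differentiable_on UNIV \<and> (\<forall>i. C_k k (partial_deriv i f))"

definition test_functions :: "(real^'n) set \<Rightarrow> (real^'n \<Rightarrow> complex) set" where
  "test_functions \<Omega> =
     {\<psi>. (\<forall>k. C_k k \<psi>) \<and> compact (closure {x. \<psi> x \<noteq> 0}) \<and> closure {x. \<psi> x \<noteq> 0} \<subseteq> \<Omega>}"

text \<open>Functions are total on \<open>real^'n\<close>, but only their values almost everywhere on
  \<open>\<Omega>\<close> matter below.\<close>

definition L2 :: "(real^'n) set \<Rightarrow> (real^'n \<Rightarrow> 'b::euclidean_space) set" where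
  "L2 \<Omega> = {f. f \<in> borel_measurable (lebesgue_on \<Omega>) \<and>
              integrable (lebesgue_on \<Omega>) (\<lambda>x. (norm (f x))\<^sup>2)}"

definition is_weak_gradient ::
    "(real^'n) set \<Rightarrow> (real^'n \<Rightarrow> complex) \<Rightarrow> (real^'n \<Rightarrow> complex^'n) \<Rightarrow> bool" where
  "is_weak_gradient \<Omega> u G \<longleftrightarrow>
     (\<forall>\<psi>\<in>test_functions \<Omega>. \<forall>i.
        (LINT x|lebesgue_on \<Omega>. u x * partial_deriv i \<psi> x) =
        - (LINT x|lebesgue_on \<Omega>. G x $ i * \<psi> x))"

definition H1 :: "(real^'n) set \<Rightarrow> (real^'n \<Rightarrow> complex) set" where
  "H1 \<Omega> = {u. u \<in> L2 \<Omega> \<and> (\<exists>G\<in>L2 \<Omega>. is_weak_gradient \<Omega> u G)}"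

text \<open>For \<open>u \<in> H1 \<Omega>\<close> the choice is unique up to null sets.\<close>

definition weak_grad :: "(real^'n) set \<Rightarrow> (real^'n \<Rightarrow> complex) \<Rightarrow> real^'n \<Rightarrow> complex^'n" where
  "weak_grad \<Omega> u = (SOME G. G \<in> L2 \<Omega> \<and> is_weak_gradient \<Omega> u G)"

definition H1_norm :: "(real^'n) set \<Rightarrow> (real^'n \<Rightarrow> complex) \<Rightarrow> real" where
  "H1_norm \<Omega> u = sqrt ((LINT x|lebesgue_on \<Omega>. (norm (u x))\<^sup>2) +
                       (LINT x|lebesgue_on \<Omega>. (norm (weak_grad \<Omega> u x))\<^sup>2))"

definition H1_0 :: "(real^'n) set \<Rightarrow> (real^'n \<Rightarrow> complex) set" where
  "H1_0 \<Omega> = {u \<in> H1 \<Omega>. \<forall>e>0. \<exists>\<psi>\<in>test_functions \<Omega>. H1_norm \<Omega> (\<lambda>x. u x - \<psi> x) < e}"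


section \<open>Functional dissipativity\<close>

text \<open>The operator \<open>E u = \<nabla>(A \<nabla>u)\<close> enters through its sesquilinear form, and
  \<open>\<Phi> s = \<integral>\<^sub>0\<^sup>s \<sigma> \<phi> \<sigma> d\<sigma>\<close> through \<open>\<phi>\<close>. Where \<open>u x = 0\<close> the factor \<open>\<phi> (cmod (u x)) *\<^sub>R u x\<close>
  is \<open>0\<close>, whatever the value of \<open>\<phi>\<close> at \<open>0\<close>.\<close>

definition LPhi_dissipative ::
    "(real^'n) set \<Rightarrow> (real^'n \<Rightarrow> complex^'n^'n) \<Rightarrow> (real \<Rightarrow> real) \<Rightarrow> bool" where
  "LPhi_dissipative \<Omega> A \<phi> \<longleftrightarrow>
     (\<forall>u\<in>H1_0 \<Omega>. (\<lambda>x. \<phi> (cmod (u x)) *\<^sub>R u x) \<in> H1_0 \<Omega> \<longrightarrow>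
        Re (LINT x|lebesgue_on \<Omega>.
              cinner (A x *v weak_grad \<Omega> u x)
                     (weak_grad \<Omega> (\<lambda>x. \<phi> (cmod (u x)) *\<^sub>R u x) x)) \<ge> 0)"

end

theory Submission
  imports Defs
begin

text \<open>
  The hypothesis gives \<open>Re \<langle>A \<nabla>u, \<nabla>(\<phi>(|u|) u)\<rangle> \<ge> 0\<close> pointwise almost everywhere. Where \<open>u \<noteq> 0\<close>, write
  \<open>\<nabla>u = sgn u (a + i b)\<close> with real vectors \<open>a\<close>, \<open>b\<close>; then \<open>\<nabla>(\<phi>(|u|) u) = sgn u (\<alpha> a + i \<beta> b)\<close> with
  \<open>\<beta> = \<phi>(s)\<close>, \<open>\<alpha> = (s \<phi>(s))'\<close> at \<open>s = |u|\<close>. For \<open>t = s \<surd>\<phi>(s)\<close> one has \<open>1 + \<Lambda>(t) = 2\<beta> / (\<alpha> + \<beta>)\<close>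
  and \<open>1 - \<Lambda>(t) = 2\<alpha> / (\<alpha> + \<beta>)\<close>, so the integrand is the given form at suitable multiples of
  \<open>a\<close> and \<open>b\<close>. Where \<open>u = 0\<close>, the gradient of \<open>u\<close> vanishes almost everywhere.

  Since both \<open>u\<close> and \<open>w = \<phi>(|u|) u\<close> are assumed to have weak gradients, the chain rule needs no growth
  condition on \<open>\<phi>\<close>: the difference quotients of \<open>u\<close> and of \<open>w\<close> converge to the weak derivatives locally
  in \<open>L\<^sup>1\<close>, hence almost everywhere along a common sequence of steps, and the pointwise chain rule
  for difference quotients applies at every point where \<open>u \<noteq> 0\<close>.
\<close>


section \<open>Smooth bump functions on boxes\<close>

text \<open>The classical flat function \<open>exp (- (1 / t))\<close>, divided by
  \<open>t ^ m\<close>: such powers occur in its derivatives, so the whole family is introduced at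
  once.\<close>

definition flat_exp :: "nat \<Rightarrow> real \<Rightarrow> real" where
  "flat_exp m t = (if t > 0 then exp (- (1 / t)) / t ^ m else 0)"

lemma flat_exp_tendsto_0: "(flat_exp m \<longlongrightarrow> 0) (at 0)"
proof -
  have "((\<lambda>t. inverse t ^ m / exp (inverse t)) \<longlongrightarrow> 0) (at_right (0::real))"
    using tendsto_power_div_exp_0 filterlim_inverse_at_top_right by (rule filterlim_compose)
  then have R: "(flat_exp m \<longlongrightarrow> 0) (at_right 0)"
    by (rule Lim_transform_eventually)
      (auto simp: flat_exp_def eventually_at_right_field exp_minus divide_simps intro!: exI[of _ 1])
  have "(flat_exp m \<longlongrightarrow> 0) (at_left 0)"
    by (rule tendsto_eventually) (auto simp: flat_exp_def eventually_at_left_field intro!: exI[of _ "-1"])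
  with R show ?thesis by (simp add: filterlim_at_split)
qed

lemma flat_exp_deriv:
  "(flat_exp m has_real_derivative flat_exp (m + 2) t - real m * flat_exp (Suc m) t) (at t)"
proof (cases t "0::real" rule: linorder_cases)
  case less
  have "((\<lambda>t. 0) has_real_derivative 0) (at t)" by simp
  then have "(flat_exp m has_real_derivative 0) (at t)"
    by (rule DERIV_cong_ev[THEN iffD1, rotated -1, OF _ refl _ refl])
      (use less in \<open>auto simp: flat_exp_def eventually_nhds intro!: exI[of _ "{..<0}"]\<close>)
  then show ?thesis using less by (simp add: flat_exp_def)
next
  case equal
  \<comment> \<open>At \<open>0\<close> the difference quotient of \<open>flat_exp m\<close> is
    \<open>flat_exp (Suc m)\<close>, so the limit of the next member of the family gives the
    derivative.\<close>
  have "((\<lambda>h. flat_exp m h / h) \<longlongrightarrow> 0) (at 0)"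
    by (rule Lim_transform_eventually[OF flat_exp_tendsto_0[of "Suc m"]])
      (auto simp: flat_exp_def eventually_at_filter)
  then show ?thesis using equal by (simp add: has_field_derivative_iff flat_exp_def)
next
  case greater
  have power_Suc_pred: "k = 0 \<or> t * t ^ (k - Suc 0) = t ^ k" for k
    by (cases k) auto
  have "((\<lambda>t. exp (- (1 / t)) / t ^ m) has_real_derivative
      flat_exp (m + 2) t - real m * flat_exp (Suc m) t) (at t)"
    using greater
    by (cases m; insert power_Suc_pred[of "m - 1"]) (auto intro!: derivative_eq_intros simp: flat_exp_def field_simps power2_eq_square)
  then show ?thesis
    by (rule DERIV_cong_ev[THEN iffD1, rotated -1, OF _ refl _ refl])
      (use greater in \<open>auto simp: flat_exp_def eventually_nhds intro!: exI[of _ "{0<..}"]\<close>)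
qed

text \<open>Chosen to be closed under partial derivatives, which gives \<open>C_k k\<close> for all \<open>k\<close> at once.\<close>

inductive_set smooth_terms :: "(real^'n \<Rightarrow> real) set" where
  const: "(\<lambda>x. c) \<in> smooth_terms"
| coord: "(\<lambda>x. x $ j) \<in> smooth_terms"
| add: "f \<in> smooth_terms \<Longrightarrow> g \<in> smooth_terms \<Longrightarrow> (\<lambda>x. f x + g x) \<in> smooth_terms"
| mult: "f \<in> smooth_terms \<Longrightarrow> g \<in> smooth_terms \<Longrightarrow> (\<lambda>x. f x * g x) \<in> smooth_terms"
| flat_exp: "f \<in> smooth_terms \<Longrightarrow> (\<lambda>x. flat_exp m (f x)) \<in> smooth_terms"

lemma smooth_terms_prod:
  assumes "finite J" "\<And>j. j \<in> J \<Longrightarrow> f j \<in> smooth_terms"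
  shows "(\<lambda>x. \<Prod>j\<in>J. f j x) \<in> smooth_terms"
  using assms by (induction J) (auto intro: smooth_terms.intros)

lemma smooth_terms_derivative:
  assumes "f \<in> smooth_terms"
  shows "\<exists>f'. (\<forall>x. (f has_derivative f' x) (at x)) \<and> (\<forall>v. (\<lambda>x. f' x v) \<in> smooth_terms)"
  using assms
proof induction
  case (const c)
  show ?case by (rule exI[of _ "\<lambda>x v. 0"]) (auto intro: smooth_terms.intros)
next
  case (coord j)
  show ?case
    by (rule exI[of _ "\<lambda>x v. v $ j"])
      (auto intro: smooth_terms.intros bounded_linear_imp_has_derivative bounded_linear_vec_nth)
next
  case (add f g)
  then obtain f' g' where "\<And>x. (f has_derivative f' x) (at x)" "\<And>v. (\<lambda>x. f' x v) \<in> smooth_terms"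
    "\<And>x. (g has_derivative g' x) (at x)" "\<And>v. (\<lambda>x. g' x v) \<in> smooth_terms" by blast
  then show ?case
    by (intro exI[of _ "\<lambda>x v. f' x v + g' x v"]) (auto intro: smooth_terms.intros has_derivative_add)
next
  case (mult f g)
  then obtain f' g' where *: "\<And>x. (f has_derivative f' x) (at x)" "\<And>v. (\<lambda>x. f' x v) \<in> smooth_terms"
    "\<And>x. (g has_derivative g' x) (at x)" "\<And>v. (\<lambda>x. g' x v) \<in> smooth_terms" by blast
  show ?case
    by (intro exI[of _ "\<lambda>x v. f x * g' x v + f' x v * g x"] conjI allI has_derivative_mult
        smooth_terms.add smooth_terms.mult * mult)
next
  case (flat_exp f m)
  then obtain f' where *: "\<And>x. (f has_derivative f' x) (at x)" "\<And>v. (\<lambda>x. f' x v) \<in> smooth_terms"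
    by blast
  have "((\<lambda>x. flat_exp m (f x)) has_derivative
      (\<lambda>v. (flat_exp (m + 2) (f x) + (- real m) * flat_exp (Suc m) (f x)) * f' x v)) (at x)" for x
    using has_derivative_compose[OF *(1)[of x] flat_exp_deriv[of m "f x", unfolded has_field_derivative_def]]
    by simp
  then show ?case
    by (intro exI[of _ "\<lambda>x v. (flat_exp (m + 2) (f x) + (- real m) * flat_exp (Suc m) (f x)) * f' x v"]
        conjI allI smooth_terms.mult smooth_terms.add smooth_terms.const smooth_terms.flat_exp * flat_exp)
      auto
qed

lemma smooth_terms_C_k:
  assumes "f \<in> smooth_terms"
  shows "C_k k (\<lambda>x. complex_of_real (f x))"
  using assms
proof (induction k arbitrary: f)
  case 0
  then have "f differentiable (at x)" for x
    using smooth_terms_derivative unfolding differentiable_def by blast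
  then have "continuous_on UNIV f"
    by (simp add: continuous_at_imp_continuous_on differentiable_imp_continuous_within)
  then show ?case by (auto intro: continuous_intros)
next
  case (Suc k)
  obtain f' where *: "\<And>x. (f has_derivative f' x) (at x)" "\<And>v. (\<lambda>x. f' x v) \<in> smooth_terms"
    using smooth_terms_derivative[OF Suc.prems] by blast
  have d: "((\<lambda>x. complex_of_real (f x)) has_derivative (\<lambda>v. complex_of_real (f' x v))) (at x)" for x
    using has_derivative_of_real[OF *(1)] .
  then have "partial_deriv i (\<lambda>x. complex_of_real (f x)) = (\<lambda>x. complex_of_real (f' x (axis i 1)))" for i
    using frechet_derivative_at[OF d] by (simp add: partial_deriv_def fun_eq_iff)
  then show ?case
    using d Suc.IH[OF *(2)] by (auto simp: differentiable_on_def differentiable_def)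
qed

text \<open>Letting \<open>n\<close> grow steepens the edges without moving the zero set: all these
  functions are positive exactly on \<open>box a b\<close> and tend to its indicator.\<close>

definition box_bump :: "nat \<Rightarrow> real^'n \<Rightarrow> real^'n \<Rightarrow> real^'n \<Rightarrow> real" where
  "box_bump n a b x = (\<Prod>j\<in>UNIV.
     flat_exp 0 (real (Suc n) * (x $ j - a $ j)) * flat_exp 0 (real (Suc n) * (b $ j - x $ j)))"

lemma flat_exp_eq_0_iff: "flat_exp m t = 0 \<longleftrightarrow> t \<le> 0"
  by (auto simp: flat_exp_def)

lemma flat_exp_0_bounds: "0 \<le> flat_exp 0 t" "flat_exp 0 t \<le> 1"
  by (auto simp: flat_exp_def)

lemma box_bump_bounds: "0 \<le> box_bump n a b x" "box_bump n a b x \<le> 1"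
  unfolding box_bump_def
  by (auto intro!: prod_nonneg prod_le_1 mult_nonneg_nonneg mult_le_one flat_exp_0_bounds)

lemma box_bump_eq_0_iff: "box_bump n a b x = 0 \<longleftrightarrow> x \<notin> box a b"
  by (auto simp: box_bump_def mem_box_cart flat_exp_eq_0_iff mult_le_0_iff not_less)

lemma box_bump_smooth: "box_bump n a b \<in> smooth_terms"
proof -
  have eq: "box_bump n a b = (\<lambda>x. \<Prod>j\<in>UNIV.
     flat_exp 0 (real (Suc n) * (x $ j + - a $ j)) * flat_exp 0 (real (Suc n) * (b $ j + (-1) * x $ j)))"
    by (auto simp: box_bump_def fun_eq_iff)
  show ?thesis unfolding eq
    by (intro smooth_terms_prod smooth_terms.intros finite)
qed

lemma box_bump_tendsto: "(\<lambda>n. box_bump n a b x) \<longlonglongrightarrow> indicator (box a b) x"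
proof (cases "x \<in> box a b")
  case True
  have 1: "(\<lambda>n. flat_exp 0 (real (Suc n) * t)) \<longlonglongrightarrow> 1" if "t > 0" for t
  proof -
    have "(\<lambda>n. exp (- (inverse (real (Suc n)) * inverse t))) \<longlonglongrightarrow> exp (- (0 * inverse t))"
      by (intro tendsto_intros LIMSEQ_inverse_real_of_nat)
    then show ?thesis using that by (simp add: flat_exp_def divide_simps mult.commute)
  qed
  have "(\<lambda>n. box_bump n a b x) \<longlonglongrightarrow> (\<Prod>j\<in>(UNIV::'a set). 1 * 1)"
    unfolding box_bump_def using True
    by (intro tendsto_prod tendsto_mult 1) (auto simp: mem_box_cart)
  with True show ?thesis by simp
next
  case False
  then have "box_bump n a b x = 0" for n by (simp add: box_bump_eq_0_iff)
  with False show ?thesis by simp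
qed

lemma box_bump_test_function:
  assumes "cbox a b \<subseteq> \<Omega>"
  shows "(\<lambda>x. complex_of_real (box_bump n a b x)) \<in> test_functions \<Omega>"
proof -
  have "{x. complex_of_real (box_bump n a b x) \<noteq> 0} = box a b"
    by (auto simp: box_bump_eq_0_iff)
  moreover have "closure (box a b) \<subseteq> cbox a b"
    by (intro closure_minimal box_subset_cbox closed_cbox)
  moreover have "compact (closure (box a b))"
    by (simp add: bounded_box compact_closure)
  ultimately show ?thesis
    using assms by (auto simp: test_functions_def smooth_terms_C_k box_bump_smooth)
qed


section \<open>Continuity of translations in the mean\<close>

lemma integrable_translate:
  fixes f :: "'a::euclidean_space \<Rightarrow> 'b::{banach, second_countable_topology}"
  assumes "integrable lborel f"
  shows "integrable lborel (\<lambda>x. f (x + h))"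
    and "(\<integral>x. f (x + h) \<partial>lborel) = integral\<^sup>L lborel f"
proof -
  have [measurable]: "f \<in> borel_measurable borel" using assms by (auto dest: borel_measurable_integrable)
  have eq: "lborel = distr lborel borel ((+) h)" by (rule lborel_distr_plus[symmetric])
  have "integrable (distr lborel borel ((+) h)) f" using assms eq by simp
  then show "integrable lborel (\<lambda>x. f (x + h))"
    by (subst (asm) integrable_distr_eq) (auto simp: add.commute)
  have "integral\<^sup>L lborel f = integral\<^sup>L (distr lborel borel ((+) h)) f" using eq by simp
  also have "\<dots> = (\<integral>x. f (x + h) \<partial>lborel)" by (subst integral_distr) (auto simp: add.commute)
  finally show "(\<integral>x. f (x + h) \<partial>lborel) = integral\<^sup>L lborel f" by simp
qed

definition L1_shift_continuous :: "('a::euclidean_space \<Rightarrow> 'b::{banach, second_countable_topology}) \<Rightarrow> bool" where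
  "L1_shift_continuous f \<longleftrightarrow> ((\<lambda>h. \<integral>x. norm (f (x + h) - f x) \<partial>lborel) \<longlongrightarrow> 0) (at 0)"

text \<open>A three-term estimate: by translation invariance the shifted error
  \<open>f (x + h) - g (x + h)\<close> has the same L1 norm as the unshifted one, so closeness to a
  shift-continuous \<open>g\<close> suffices.\<close>

lemma L1_shift_continuous_approx:
  fixes f :: "'a::euclidean_space \<Rightarrow> 'b::{banach, second_countable_topology}"
  assumes f: "integrable lborel f"
    and approx: "\<And>e. e > 0 \<Longrightarrow> \<exists>g. integrable lborel g \<and> L1_shift_continuous g \<and> (\<integral>x. norm (f x - g x) \<partial>lborel) < e"
  shows "L1_shift_continuous f"
  unfolding L1_shift_continuous_def
proof (rule tendstoI)
  fix e :: real assume "e > 0"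
  then obtain g where g: "integrable lborel g" "L1_shift_continuous g" "(\<integral>x. norm (f x - g x) \<partial>lborel) < e / 3"
    using approx[of "e / 3"] by auto
  have "\<forall>\<^sub>F h in at 0. dist (\<integral>x. norm (g (x + h) - g x) \<partial>lborel) 0 < e / 3"
    using g(2) \<open>e > 0\<close> unfolding L1_shift_continuous_def by (auto dest: tendstoD[where e = "e / 3"])
  then show "\<forall>\<^sub>F h in at 0. dist (\<integral>x. norm (f (x + h) - f x) \<partial>lborel) 0 < e"
  proof eventually_elim
    case (elim h)
    let ?k = "\<lambda>x. norm (f x - g x)"
    have k: "integrable lborel ?k" using f g by auto
    note int = integrable_translate(1)[OF f, of h] integrable_translate(1)[OF g(1), of h]
      integrable_translate(1)[OF k, of h] f g(1) k
    have "(\<integral>x. norm (f (x + h) - f x) \<partial>lborel) \<le>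
        (\<integral>x. ?k (x + h) + norm (g (x + h) - g x) + ?k x \<partial>lborel)"
      by (intro integral_mono Bochner_Integration.integrable_add integrable_norm
          Bochner_Integration.integrable_diff int) norm
    also have "\<dots> = (\<integral>x. ?k (x + h) \<partial>lborel) + (\<integral>x. norm (g (x + h) - g x) \<partial>lborel) + integral\<^sup>L lborel ?k"
      using int by simp
    also have "\<dots> < e" using elim g(3) integrable_translate(2)[OF k, of h] by simp
    finally show ?case by simp
  qed
qed

text \<open>A point of an open \<open>U\<close> stays in \<open>U\<close> under all small shifts, so
  the measure of what leaves \<open>U\<close> tends to \<open>0\<close> by dominated convergence.
  Points entering under \<open>h\<close> are, after a translation, points leaving under
  \<open>- h\<close>.\<close>

lemma L1_shift_continuous_open:
  fixes U :: "'a::euclidean_space set" and c :: "'b::{banach, second_countable_topology}"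
  assumes U: "open U" "emeasure lborel U < \<infinity>"
  shows "L1_shift_continuous (\<lambda>x. indicator U x *\<^sub>R c)"
  unfolding L1_shift_continuous_def tendsto_at_iff_sequentially
proof (intro allI impI)
  fix X :: "nat \<Rightarrow> 'a" assume X: "X \<longlonglongrightarrow> 0"
  have [measurable]: "U \<in> sets borel" using U by simp
  have iU: "integrable lborel (indicator U :: 'a \<Rightarrow> real)" using U by simp
  \<comment> \<open>\<open>?d h\<close> is the indicator of the points of \<open>U\<close> that a
    shift by \<open>h\<close> moves out of \<open>U\<close>.\<close>
  let ?d = "\<lambda>h x. indicator U x * (1 - indicator U (x + h)) :: real"
  have lim: "(\<lambda>n. integral\<^sup>L lborel (?d (Y n))) \<longlonglongrightarrow> 0" if Y: "Y \<longlonglongrightarrow> 0" for Y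
  proof -
    have "(\<lambda>n. integral\<^sup>L lborel (?d (Y n))) \<longlonglongrightarrow> integral\<^sup>L lborel (\<lambda>x::'a. 0::real)"
    proof (rule integral_dominated_convergence[where w = "indicator U"])
      show "AE x in lborel. (\<lambda>n. ?d (Y n) x) \<longlonglongrightarrow> 0"
      proof (rule AE_I2)
        fix x
        show "(\<lambda>n. ?d (Y n) x) \<longlonglongrightarrow> 0"
        proof (cases "x \<in> U")
          case True
          have "(\<lambda>n. x + Y n) \<longlonglongrightarrow> x + 0" by (intro tendsto_intros Y)
          with True U have "\<forall>\<^sub>F n in sequentially. x + Y n \<in> U" by (auto dest: topological_tendstoD)
          then have "\<forall>\<^sub>F n in sequentially. ?d (Y n) x = 0" by eventually_elim simp
          then show ?thesis by (rule tendsto_eventually)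
        qed simp
      qed
    qed (use iU in \<open>auto split: split_indicator\<close>)
    then show ?thesis by simp
  qed
  have id: "integrable lborel (?d h)" for h
    by (rule Bochner_Integration.integrable_bound[OF iU]) (auto split: split_indicator)
  have "(\<integral>x. norm (indicator U (x + h) *\<^sub>R c - indicator U x *\<^sub>R c) \<partial>lborel) =
      norm c * (integral\<^sup>L lborel (?d h) + integral\<^sup>L lborel (?d (- h)))" for h
  proof -
    have "(\<integral>x. norm (indicator U (x + h) *\<^sub>R c - indicator U x *\<^sub>R c) \<partial>lborel) =
        (\<integral>x. norm c * (?d h x + ?d (- h) (x + h)) \<partial>lborel)"
      by (intro Bochner_Integration.integral_cong) (auto split: split_indicator)
    also have "\<dots> = norm c * (integral\<^sup>L lborel (?d h) + (\<integral>x. ?d (- h) (x + h) \<partial>lborel))"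
      using id[of h] integrable_translate(1)[OF id[of "- h"], of h]
      by (subst Bochner_Integration.integral_mult_right_zero, subst Bochner_Integration.integral_add) auto
    finally show ?thesis using integrable_translate(2)[OF id[of "- h"], of h] by simp
  qed
  moreover have "(\<lambda>n. norm c * (integral\<^sup>L lborel (?d (X n)) + integral\<^sup>L lborel (?d (- X n)))) \<longlonglongrightarrow> norm c * (0 + 0)"
    using lim[OF X] lim[of "\<lambda>n. - X n"] tendsto_minus[OF X] by (intro tendsto_intros) auto
  ultimately show "((\<lambda>h. \<integral>x. norm (indicator U (x + h) *\<^sub>R c - indicator U x *\<^sub>R c) \<partial>lborel) \<circ> X) \<longlonglongrightarrow> 0"
    by (simp add: o_def)
qed

text \<open>Induction over indicators, sums and dominated limits; sets of finite measure reduce to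
  open ones by outer regularity.\<close>

lemma integrable_imp_L1_shift_continuous:
  fixes f :: "'a::euclidean_space \<Rightarrow> 'b::{banach, second_countable_topology}"
  assumes "integrable lborel f"
  shows "L1_shift_continuous f"
  using assms
proof (induction rule: integrable_induct)
  case (base A c)
  then have A[measurable]: "A \<in> sets borel" by simp
  show ?case
  proof (rule L1_shift_continuous_approx)
    show "integrable lborel (\<lambda>x. indicator A x *\<^sub>R c)" using base by simp
    fix e :: real assume "e > 0"
    \<comment> \<open>The denominator \<open>norm c + 1\<close> stays positive when
      \<open>c = 0\<close>.\<close>
    then have e': "e / (norm c + 1) > 0" by (intro divide_pos_pos add_nonneg_pos) auto
    obtain U where U: "open U" "A \<subseteq> U" "emeasure lborel (U - A) < ennreal (e / (norm c + 1))"
      using outer_regular_lborel[OF A e'] by auto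
    have [measurable]: "U \<in> sets borel" using U by simp
    have "emeasure lborel U = emeasure lborel A + emeasure lborel (U - A)"
      using U by (subst plus_emeasure) (auto intro: arg_cong[where f = "emeasure lborel"])
    also have "\<dots> < \<infinity>" using base U(3) by (auto simp: less_top[symmetric])
    finally have fin: "emeasure lborel U < \<infinity>" .
    have "(\<integral>x. norm (indicator A x *\<^sub>R c - indicator U x *\<^sub>R c) \<partial>lborel) = (\<integral>x. norm c * indicator (U - A) x \<partial>lborel)"
      using U by (intro Bochner_Integration.integral_cong) (auto split: split_indicator)
    also have "\<dots> = norm c * measure lborel (U - A)" by simp
    also have "\<dots> \<le> norm c * (e / (norm c + 1))"
      using U(3) e' by (intro mult_left_mono) (auto simp: measure_def intro!: enn2real_leI)
    also have "\<dots> < e"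
    proof -
      have "norm c + 1 > 0" by (simp add: add_nonneg_pos)
      then show ?thesis using \<open>e > 0\<close> by (simp add: pos_divide_less_eq algebra_simps)
    qed
    finally show "\<exists>g. integrable lborel g \<and> L1_shift_continuous g \<and> (\<integral>x. norm (indicator A x *\<^sub>R c - g x) \<partial>lborel) < e"
      using L1_shift_continuous_open[OF U(1) fin, of c] fin
      by (intro exI[of _ "\<lambda>x. indicator U x *\<^sub>R c"]) auto
  qed
next
  case (add f g)
  have fg: "integrable lborel f" "integrable lborel g" by fact+
  note int = integrable_translate(1)[OF fg(1)] integrable_translate(1)[OF fg(2)] fg
  have "((\<lambda>h. (\<integral>x. norm (f (x + h) - f x) \<partial>lborel) + (\<integral>x. norm (g (x + h) - g x) \<partial>lborel)) \<longlongrightarrow> 0 + 0) (at 0)"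
    using add unfolding L1_shift_continuous_def by (intro tendsto_add)
  then have "((\<lambda>h. (\<integral>x. norm (f (x + h) - f x) \<partial>lborel) + (\<integral>x. norm (g (x + h) - g x) \<partial>lborel)) \<longlongrightarrow> 0) (at 0)"
    by simp
  then show ?case
    unfolding L1_shift_continuous_def
  proof (rule tendsto_sandwich[OF _ _ tendsto_const, rotated -1])
    show "\<forall>\<^sub>F h in at 0. (\<integral>x. norm (f (x + h) + g (x + h) - (f x + g x)) \<partial>lborel) \<le>
        (\<integral>x. norm (f (x + h) - f x) \<partial>lborel) + (\<integral>x. norm (g (x + h) - g x) \<partial>lborel)"
    proof (rule always_eventually, rule allI)
      fix h
      have "(\<integral>x. norm (f (x + h) + g (x + h) - (f x + g x)) \<partial>lborel) \<le>
          (\<integral>x. norm (f (x + h) - f x) + norm (g (x + h) - g x) \<partial>lborel)"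
        by (intro integral_mono Bochner_Integration.integrable_add integrable_norm
            Bochner_Integration.integrable_diff int) norm
      then show "(\<integral>x. norm (f (x + h) + g (x + h) - (f x + g x)) \<partial>lborel) \<le>
          (\<integral>x. norm (f (x + h) - f x) \<partial>lborel) + (\<integral>x. norm (g (x + h) - g x) \<partial>lborel)"
        using int by simp
    qed
  qed auto
next
  case (lim f s)
  show ?case
  proof (rule L1_shift_continuous_approx)
    show "integrable lborel f" by fact
    fix e :: real assume "e > 0"
    have [measurable]: "f \<in> borel_measurable borel" "\<And>i. s i \<in> borel_measurable borel"
      using lim by (auto dest: borel_measurable_integrable)
    \<comment> \<open>The induction rule supplies \<open>norm (s i x) \<le> 2 * norm (f x)\<close>,
      whence the dominating function \<open>3 * norm (f x)\<close>.\<close>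
    have "(\<lambda>i. \<integral>x. norm (f x - s i x) \<partial>lborel) \<longlonglongrightarrow> (\<integral>x. norm (f x - f x) \<partial>lborel)"
    proof (rule integral_dominated_convergence[where w = "\<lambda>x. 3 * norm (f x)"])
      show "AE x in lborel. (\<lambda>i. norm (f x - s i x)) \<longlonglongrightarrow> norm (f x - f x)"
        by (intro AE_I2 tendsto_intros lim) simp
      show "AE x in lborel. norm (norm (f x - s i x)) \<le> 3 * norm (f x)" for i
      proof (rule AE_I2)
        fix x
        have "norm (s i x) \<le> 2 * norm (f x)" using lim by simp
        then show "norm (norm (f x - s i x)) \<le> 3 * norm (f x)"
          using norm_triangle_ineq4[of "f x" "s i x"] by simp
      qed
    qed (use lim in auto)
    then have "\<forall>\<^sub>F i in sequentially. (\<integral>x. norm (f x - s i x) \<partial>lborel) < e"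
      using \<open>e > 0\<close> by (auto dest: order_tendstoD)
    then obtain i where "(\<integral>x. norm (f x - s i x) \<partial>lborel) < e"
      by (auto simp: eventually_sequentially)
    with lim show "\<exists>g. integrable lborel g \<and> L1_shift_continuous g \<and> (\<integral>x. norm (f x - g x) \<partial>lborel) < e"
      by (intro exI[of _ "s i"]) auto
  qed
qed

section \<open>Integrable functions whose integrals over all boxes vanish\<close>

lemma AE_eq_0_if_box_integrals_0:
  fixes f :: "'a::euclidean_space \<Rightarrow> 'b::{banach, second_countable_topology}"
  assumes f: "integrable lborel f"
    and box: "\<And>a b. (\<integral>x. indicator (box a b) x *\<^sub>R f x \<partial>lborel) = 0"
  shows "AE x in lborel. f x = 0"
proof (rule sigma_finite_measure.density_zero[OF sigma_finite_lborel f])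
  fix A :: "'a set" assume "A \<in> sets lborel"
  let ?G = "range (\<lambda>(a, b). box a b :: 'a set)"
  have sets_eq: "sets borel = sigma_sets UNIV ?G"
    by (subst borel_eq_box) simp
  have int: "set_integrable lborel B f" if "B \<in> sets borel" for B
    unfolding set_integrable_def by (rule integrable_mult_indicator) (use that f in auto)
  \<comment> \<open>The complement step below needs the integral over the whole space, which is a
    limit of integrals over growing boxes.\<close>
  have total: "integral\<^sup>L lborel f = 0"
  proof -
    let ?B = "\<lambda>n::nat. box (- (real n *\<^sub>R One)) (real n *\<^sub>R One) :: 'a set"
    have "(\<lambda>n. \<integral>x. indicator (?B n) x *\<^sub>R f x \<partial>lborel) \<longlonglongrightarrow> integral\<^sup>L lborel f"
    proof (rule integral_dominated_convergence[where w = "\<lambda>x. norm (f x)"])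
      show "AE x in lborel. (\<lambda>n. indicator (?B n) x *\<^sub>R f x) \<longlonglongrightarrow> f x"
      proof (rule AE_I2)
        fix x :: 'a
        obtain n where "x \<in> ?B n" using UN_box_eq_UNIV[where 'a = 'a] by blast
        then have "\<forall>m\<ge>n. x \<in> ?B m" by (fastforce simp: mem_box inner_Basis)
        then show "(\<lambda>n. indicator (?B n) x *\<^sub>R f x) \<longlonglongrightarrow> f x"
          by (intro tendsto_eventually) (auto simp: eventually_sequentially intro!: exI[of _ n])
      qed
    qed (use f in \<open>auto split: split_indicator\<close>)
    then show ?thesis using box by (simp add: LIMSEQ_const_iff)
  qed
  \<comment> \<open>Boxes generate the Borel sets and are closed under intersection, so it is enough
    that vanishing set integrals pass to complements and to countable disjoint unions.\<close>
  have "Int_stable ?G" by (auto simp: Int_stable_def box_Int_box)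
  moreover have "?G \<subseteq> Pow UNIV" by simp
  moreover have "A \<in> sigma_sets UNIV ?G" using \<open>A \<in> sets lborel\<close> sets_eq by simp
  ultimately show "set_lebesgue_integral lborel A f = 0"
  proof (induction rule: sigma_sets_induct_disjoint)
    case (compl A)
    then have A: "A \<in> sets borel" using sets_eq by simp
    have "set_lebesgue_integral lborel (UNIV - A) f =
        (\<integral>x. f x - indicator A x *\<^sub>R f x \<partial>lborel)"
      unfolding set_lebesgue_integral_def
      by (intro Bochner_Integration.integral_cong) (auto split: split_indicator)
    also have "\<dots> = 0"
      using int[OF A] f total compl(2) by (simp add: set_integrable_def set_lebesgue_integral_def)
    finally show ?case .
  next
    case (union A)
    then have "\<And>i. A i \<in> sets borel" using sets_eq by auto
    then show ?case
      using union by (subst lebesgue_integral_countable_add) (auto simp: disjoint_family_on_def intro!: int)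
  qed (use box in \<open>auto simp: set_lebesgue_integral_def\<close>)
qed


section \<open>Difference quotients and weak derivatives\<close>

lemma partial_deriv_eq_0_outside_support:
  assumes "x \<notin> closure {x. \<psi> x \<noteq> 0}"
  shows "partial_deriv i \<psi> x = 0"
proof -
  have "((\<lambda>x. 0) has_derivative (\<lambda>v. 0)) (at x)" by simp
  then have "(\<psi> has_derivative (\<lambda>v. 0)) (at x)"
    by (rule has_derivative_transform_within_open[where s = "- closure {x. \<psi> x \<noteq> 0}"])
      (use assms closure_subset[of "{x. \<psi> x \<noteq> 0}"] in auto)
  then have "(\<lambda>v. 0) = frechet_derivative \<psi> (at x)" by (rule frechet_derivative_at)
  then show ?thesis by (simp add: partial_deriv_def fun_eq_iff)
qed

lemma test_function_bounded:
  assumes "\<psi> \<in> test_functions \<Omega>"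
  shows "\<psi> \<in> borel_measurable borel" "\<exists>C. \<forall>x. norm (\<psi> x) \<le> C" "\<psi> differentiable (at x)"
    and "continuous_on UNIV (partial_deriv i \<psi>)" "\<exists>C. \<forall>x. norm (partial_deriv i \<psi> x) \<le> C"
proof -
  let ?K = "closure {x. \<psi> x \<noteq> 0}"
  have C: "C_k 1 \<psi>" "C_k 2 \<psi>" and K: "compact ?K"
    using assms by (auto simp: test_functions_def)
  then show diff: "\<psi> differentiable (at x)" for x by (simp add: differentiable_on_def)
  then have cont: "continuous_on UNIV \<psi>"
    by (simp add: continuous_at_imp_continuous_on differentiable_imp_continuous_within)
  show cD: "continuous_on UNIV (partial_deriv i \<psi>)" using C(1) by simp
  show "\<psi> \<in> borel_measurable borel" using cont by (rule borel_measurable_continuous_onI)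
  have *: "\<exists>C. \<forall>x. norm (f x) \<le> C" if f: "continuous_on UNIV f" "\<And>x. x \<notin> ?K \<Longrightarrow> f x = 0" for f :: "real^'a \<Rightarrow> complex"
  proof -
    have "bounded (f ` ?K)"
      using compact_continuous_image[OF continuous_on_subset[OF f(1)] K] by (simp add: compact_imp_bounded)
    then obtain B where B: "\<And>x. x \<in> ?K \<Longrightarrow> norm (f x) \<le> B" by (auto simp: bounded_iff)
    have "norm (f x) \<le> max B 0" for x using B[of x] f(2)[of x] by (cases "x \<in> ?K") auto
    then show ?thesis by blast
  qed
  show "\<exists>C. \<forall>x. norm (\<psi> x) \<le> C"
    by (rule *[OF cont]) (use closure_subset[of "{x. \<psi> x \<noteq> 0}"] in auto)
  show "\<exists>C. \<forall>x. norm (partial_deriv i \<psi> x) \<le> C"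
    by (rule *[OF cD]) (rule partial_deriv_eq_0_outside_support)
qed

text \<open>Supplies the joint integrability for the Fubini swaps below: by translation invariance
  every slice in \<open>x\<close> with \<open>s\<close> in \<open>{0..h}\<close> has the same L1
  norm as \<open>g\<close>.\<close>

lemma integrable_line_shift:
  fixes g :: "'a::euclidean_space \<Rightarrow> 'b::{banach, second_countable_topology}"
  assumes g: "integrable lborel g"
  shows "integrable (lborel \<Otimes>\<^sub>M lborel) (\<lambda>(s::real, x). indicator {0..h} s *\<^sub>R g (x + s *\<^sub>R e))"
proof (rule lborel_pair.Fubini_integrable)
  have [measurable]: "g \<in> borel_measurable borel" using g by (auto dest: borel_measurable_integrable)
  show "(\<lambda>(s::real, x). indicator {0..h} s *\<^sub>R g (x + s *\<^sub>R e)) \<in> borel_measurable (lborel \<Otimes>\<^sub>M lborel)"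
    by measurable
  have "integrable lborel (\<lambda>s. indicator {0..h} s * (\<integral>x. norm (g x) \<partial>lborel))"
    by (intro integrable_mult_left integrable_real_indicator) (auto simp: emeasure_lborel_Icc_eq)
  then show "integrable lborel (\<lambda>s. \<integral>x. norm (case (s, x) of (s, x) \<Rightarrow> indicator {0..h} s *\<^sub>R g (x + s *\<^sub>R e)) \<partial>lborel)"
    using integrable_translate(2)[OF integrable_norm[OF g]] by simp
  show "AE s in lborel. integrable lborel (\<lambda>x. case (s, x) of (s, x) \<Rightarrow> indicator {0..h} s *\<^sub>R g (x + s *\<^sub>R e))"
    using integrable_translate(1)[OF g] by simp
qed

text \<open>The fundamental theorem of calculus along a segment, in weak form. The shift is moved
  from \<open>U\<close> to \<open>\<psi>\<close>, where
  \<open>\<psi> x - \<psi> (x - h *\<^sub>R e)\<close> is the integral of a genuine derivative; for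
  each \<open>s\<close> the weak derivative is tested against a translate of \<open>\<psi>\<close>,
  and Fubini restores the order of integration.\<close>

lemma weak_difference_identity:
  fixes U g :: "real^'n \<Rightarrow> complex" and i :: 'n
  defines "e \<equiv> axis i 1"
  assumes U: "integrable lborel U" and g: "integrable lborel g"
    and weak: "\<And>\<psi>. \<psi> \<in> test_functions \<Omega> \<Longrightarrow>
        (\<integral>x. U x * partial_deriv i \<psi> x \<partial>lborel) = - (\<integral>x. g x * \<psi> x \<partial>lborel)"
    and \<psi>: "\<And>s. 0 \<le> s \<Longrightarrow> s \<le> h \<Longrightarrow> (\<lambda>x. \<psi> (x - s *\<^sub>R e)) \<in> test_functions \<Omega>"
    and h: "h \<ge> 0"
  shows "(\<integral>x. (U (x + h *\<^sub>R e) - U x) * \<psi> x \<partial>lborel) =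
    (\<integral>x. (\<integral>s. indicator {0..h} s *\<^sub>R g (x + s *\<^sub>R e) \<partial>lborel) * \<psi> x \<partial>lborel)"
proof -
  have \<psi>0: "\<psi> \<in> test_functions \<Omega>" using \<psi>[of 0] h by simp
  note tf = test_function_bounded[OF \<psi>0]
  define D where "D = partial_deriv i \<psi>"
  have [measurable]: "\<psi> \<in> borel_measurable borel" by (fact tf(1))
  have [measurable]: "D \<in> borel_measurable borel"
    unfolding D_def by (rule borel_measurable_continuous_onI) (fact tf(4))
  have [measurable]: "U \<in> borel_measurable borel" "g \<in> borel_measurable borel"
    using U g by (auto dest: borel_measurable_integrable)
  obtain C where C: "\<And>x. norm (\<psi> x) \<le> C" using tf(2) by blast
  obtain C' where C': "\<And>x. norm (D x) \<le> C'" using tf(5) unfolding D_def by blast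
  have C'0: "C' \<ge> 0" using order_trans[OF norm_ge_zero C'] by blast
  have bnd: "integrable lborel (\<lambda>x. f x * k x)"
    if "integrable lborel f" "k \<in> borel_measurable borel" "\<And>x. norm (k x) \<le> B" for f k :: "real^'n \<Rightarrow> complex" and B
  proof (rule Bochner_Integration.integrable_bound[where f = "\<lambda>x. norm (f x) * B"])
    show "AE x in lborel. norm (f x * k x) \<le> norm (norm (f x) * B)"
    proof (rule AE_I2)
      fix x
      have "norm (f x) * norm (k x) \<le> norm (f x) * \<bar>B\<bar>"
        by (intro mult_left_mono order_trans[OF that(3)]) auto
      then show "norm (f x * k x) \<le> norm (norm (f x) * B)" by (simp add: norm_mult abs_mult)
    qed
  qed (use that(1,2) in \<open>auto dest: borel_measurable_integrable\<close>)
  have der: "(\<psi> has_derivative frechet_derivative \<psi> (at y)) (at y)" for y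
    using tf(3) frechet_derivative_works by blast
  have pd: "partial_deriv i (\<lambda>x. \<psi> (x - v)) x = D (x - v)" for v x
  proof -
    have "((\<lambda>x. \<psi> (x - v)) has_derivative frechet_derivative \<psi> (at (x - v))) (at x)"
      using has_derivative_compose[of "\<lambda>x. x - v" "\<lambda>h. h" x UNIV \<psi>] der
      by (simp add: has_derivative_diff[OF has_derivative_ident has_derivative_const, simplified])
    then show ?thesis unfolding partial_deriv_def D_def by (metis frechet_derivative_at)
  qed
  \<comment> \<open>The weak derivative is tested with the translate of \<open>\<psi>\<close> by
    \<open>s *\<^sub>R e\<close>; the translation is then moved onto \<open>g\<close>.\<close>
  have A: "(\<integral>x. U x * D (x - s *\<^sub>R e) \<partial>lborel) = - (\<integral>x. g (x + s *\<^sub>R e) * \<psi> x \<partial>lborel)"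
    if "0 \<le> s" "s \<le> h" for s
  proof -
    have "(\<integral>x. U x * D (x - s *\<^sub>R e) \<partial>lborel) = - (\<integral>x. g x * \<psi> (x - s *\<^sub>R e) \<partial>lborel)"
      using weak[OF \<psi>[OF that]] by (simp add: pd)
    also have "integrable lborel (\<lambda>x. g x * \<psi> (x - s *\<^sub>R e))"
      by (rule bnd[OF g]) (use C in auto)
    from integrable_translate(2)[OF this, of "s *\<^sub>R e"]
    have "(\<integral>x. g x * \<psi> (x - s *\<^sub>R e) \<partial>lborel) = (\<integral>x. g (x + s *\<^sub>R e) * \<psi> x \<partial>lborel)" by simp
    finally show ?thesis .
  qed
  \<comment> \<open>The calculus theorem is applied in \<open>s\<close>: the derivative of
    \<open>\<psi> (x - s *\<^sub>R e)\<close> is \<open>- D (x - s *\<^sub>R e)\<close>, which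
    accounts for the order of the two end values.\<close>
  have B: "(\<integral>s. indicator {0..h} s *\<^sub>R D (x - s *\<^sub>R e) \<partial>lborel) = \<psi> x - \<psi> (x - h *\<^sub>R e)" for x
  proof -
    have "(\<integral>s. indicator {0..h} s *\<^sub>R (- D (x - s *\<^sub>R e)) \<partial>lborel) = \<psi> (x - h *\<^sub>R e) - \<psi> (x - 0 *\<^sub>R e)"
    proof (rule integral_FTC_atLeastAtMost[OF h])
      show "continuous_on {0..h} (\<lambda>s. - D (x - s *\<^sub>R e))"
        unfolding D_def by (intro continuous_intros continuous_on_compose2[OF tf(4)]) auto
      fix s :: real
      have "((\<lambda>s. x - s *\<^sub>R e) has_derivative (\<lambda>t. - (t *\<^sub>R e))) (at s within {0..h})"
        by (auto intro!: derivative_eq_intros)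
      from has_derivative_compose[OF this der]
      have "((\<lambda>s. \<psi> (x - s *\<^sub>R e)) has_derivative (\<lambda>t. frechet_derivative \<psi> (at (x - s *\<^sub>R e)) (- (t *\<^sub>R e)))) (at s within {0..h})" .
      moreover have "linear (frechet_derivative \<psi> (at (x - s *\<^sub>R e)))"
        using der has_derivative_bounded_linear bounded_linear.linear by blast
      ultimately show "((\<lambda>s. \<psi> (x - s *\<^sub>R e)) has_vector_derivative - D (x - s *\<^sub>R e)) (at s within {0..h})"
        by (simp add: has_vector_derivative_def D_def partial_deriv_def e_def linear_neg linear_scale)
    qed
    then show ?thesis by (simp add: algebra_simps)
  qed
  have i1: "integrable lborel (\<lambda>x. U (x + h *\<^sub>R e) * \<psi> x)"
    by (rule bnd[OF integrable_translate(1)[OF U]]) (use C in auto)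
  have i2: "integrable lborel (\<lambda>x. U x * \<psi> x)" by (rule bnd[OF U]) (use C in auto)
  have i3: "integrable lborel (\<lambda>x. U x * \<psi> (x - h *\<^sub>R e))" by (rule bnd[OF U]) (use C in auto)
  have "(\<integral>x. (U (x + h *\<^sub>R e) - U x) * \<psi> x \<partial>lborel) =
      (\<integral>x. U (x + h *\<^sub>R e) * \<psi> x \<partial>lborel) - (\<integral>x. U x * \<psi> x \<partial>lborel)"
    using i1 i2 by (simp add: algebra_simps)
  also have "(\<integral>x. U (x + h *\<^sub>R e) * \<psi> x \<partial>lborel) = (\<integral>x. U x * \<psi> (x - h *\<^sub>R e) \<partial>lborel)"
    using integrable_translate(2)[OF i3, of "h *\<^sub>R e"] by simp
  also have "(\<integral>x. U x * \<psi> (x - h *\<^sub>R e) \<partial>lborel) - (\<integral>x. U x * \<psi> x \<partial>lborel) =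
      - (\<integral>x. U x * (\<psi> x - \<psi> (x - h *\<^sub>R e)) \<partial>lborel)"
    using i2 i3 by (simp add: algebra_simps)
  also have "(\<integral>x. U x * (\<psi> x - \<psi> (x - h *\<^sub>R e)) \<partial>lborel) =
      (\<integral>x. (\<integral>s. indicator {0..h} s *\<^sub>R (U x * D (x - s *\<^sub>R e)) \<partial>lborel) \<partial>lborel)"
    by (simp flip: B mult_scaleR_right)
  also have "\<dots> = (\<integral>s. (\<integral>x. indicator {0..h} s *\<^sub>R (U x * D (x - s *\<^sub>R e)) \<partial>lborel) \<partial>lborel)"
  proof (rule lborel_pair.Fubini_integral)
    \<comment> \<open>The majorant uses the bound \<open>C'\<close> of \<open>D\<close>; direction
      \<open>0\<close> in \<open>integrable_line_shift\<close> makes it constant in \<open>s\<close>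
      on \<open>{0..h}\<close>.\<close>
    have "integrable (lborel \<Otimes>\<^sub>M lborel) (\<lambda>(s::real, x). indicator {0..h} s *\<^sub>R (norm (U x) * C'))"
      using integrable_line_shift[of "\<lambda>x. norm (U x) * C'" h 0] U by simp
    then show "integrable (lborel \<Otimes>\<^sub>M lborel) (\<lambda>(s::real, x). indicator {0..h} s *\<^sub>R (U x * D (x - s *\<^sub>R e)))"
    proof (rule Bochner_Integration.integrable_bound)
      show "AE p in lborel \<Otimes>\<^sub>M lborel. norm (case p of (s::real, x) \<Rightarrow> indicator {0..h} s *\<^sub>R (U x * D (x - s *\<^sub>R e)))
          \<le> norm (case p of (s, x) \<Rightarrow> indicator {0..h} s *\<^sub>R (norm (U x) * C'))"
        using C' C'0 by (intro AE_I2) (auto simp: norm_mult indicator_def intro!: mult_left_mono)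
    qed measurable
  qed
  also have "\<dots> = (\<integral>s. (\<integral>x. - (indicator {0..h} s *\<^sub>R (g (x + s *\<^sub>R e) * \<psi> x)) \<partial>lborel) \<partial>lborel)"
  proof (rule Bochner_Integration.integral_cong[OF refl])
    fix s :: real
    show "(\<integral>x. indicator {0..h} s *\<^sub>R (U x * D (x - s *\<^sub>R e)) \<partial>lborel) =
        (\<integral>x. - (indicator {0..h} s *\<^sub>R (g (x + s *\<^sub>R e) * \<psi> x)) \<partial>lborel)"
      using A[of s] by (cases "s \<in> {0..h}") auto
  qed
  also have "\<dots> = - (\<integral>s. (\<integral>x. (indicator {0..h} s *\<^sub>R (g (x + s *\<^sub>R e) * \<psi> x)) \<partial>lborel) \<partial>lborel)"
    by simp
  also have "(\<integral>s. (\<integral>x. (indicator {0..h} s *\<^sub>R (g (x + s *\<^sub>R e) * \<psi> x)) \<partial>lborel) \<partial>lborel) =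
    (\<integral>x. (\<integral>s. (indicator {0..h} s *\<^sub>R (g (x + s *\<^sub>R e) * \<psi> x)) \<partial>lborel) \<partial>lborel)"
  proof (rule lborel_pair.Fubini_integral[symmetric])
    have "integrable (lborel \<Otimes>\<^sub>M lborel) (\<lambda>p. C *\<^sub>R (case p of (s::real, x) \<Rightarrow> indicator {0..h} s *\<^sub>R g (x + s *\<^sub>R e)))"
      by (intro integrable_scaleR_right integrable_line_shift g)
    then show "integrable (lborel \<Otimes>\<^sub>M lborel) (\<lambda>(s::real, x). indicator {0..h} s *\<^sub>R (g (x + s *\<^sub>R e) * \<psi> x))"
    proof (rule Bochner_Integration.integrable_bound)
      have "norm (g y) * norm (\<psi> x) \<le> \<bar>C\<bar> * norm (g y)" for x y
        using mult_left_mono[OF order_trans[OF C[of x] abs_ge_self] norm_ge_zero[of "g y"]] by (simp add: mult.commute)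
      then show "AE p in lborel \<Otimes>\<^sub>M lborel. norm (case p of (s::real, x) \<Rightarrow> indicator {0..h} s *\<^sub>R (g (x + s *\<^sub>R e) * \<psi> x))
          \<le> norm (C *\<^sub>R (case p of (s, x) \<Rightarrow> indicator {0..h} s *\<^sub>R g (x + s *\<^sub>R e)))"
        by (intro AE_I2) (auto simp: norm_mult indicator_def)
    qed measurable
  qed
  also have "\<dots> = (\<integral>x. (\<integral>s. indicator {0..h} s *\<^sub>R g (x + s *\<^sub>R e) \<partial>lborel) * \<psi> x \<partial>lborel)"
    by (simp flip: mult_scaleR_left)
  finally show ?thesis by simp
qed

lemma box_bump_translate: "box_bump n a b (x - v) = box_bump n (a + v) (b + v) x"
  by (simp add: box_bump_def algebra_simps)

text \<open>The difference \<open>k\<close> of the two sides integrates to \<open>0\<close> against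
  every bump on a subbox, and letting the bumps tend to indicators makes its integrals over subboxes
  vanish. Since all segments starting in the closed box stay in \<Omega>, the translated bumps are
  test functions on \<Omega>.\<close>

lemma AE_difference_eq_line_integral:
  fixes U g :: "real^'n \<Rightarrow> complex" and i :: 'n
  defines "e \<equiv> axis i 1"
  assumes U: "integrable lborel U" and g: "integrable lborel g"
    and weak: "\<And>\<psi>. \<psi> \<in> test_functions \<Omega> \<Longrightarrow>
        (\<integral>x. U x * partial_deriv i \<psi> x \<partial>lborel) = - (\<integral>x. g x * \<psi> x \<partial>lborel)"
    and h: "h \<ge> 0"
    and sub: "\<And>x s. x \<in> cbox a b \<Longrightarrow> 0 \<le> s \<Longrightarrow> s \<le> h \<Longrightarrow> x + s *\<^sub>R e \<in> \<Omega>"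
  shows "AE x in lborel. x \<in> box a b \<longrightarrow>
    U (x + h *\<^sub>R e) - U x = (\<integral>s. indicator {0..h} s *\<^sub>R g (x + s *\<^sub>R e) \<partial>lborel)"
proof -
  define I where "I x = (\<integral>s. indicator {0..h} s *\<^sub>R g (x + s *\<^sub>R e) \<partial>lborel)" for x
  define k where "k x = U (x + h *\<^sub>R e) - U x - I x" for x
  have iI: "integrable lborel I"
    unfolding I_def using lborel_pair.integrable_snd[OF integrable_line_shift[OF g]] .
  have iD: "integrable lborel (\<lambda>x. U (x + h *\<^sub>R e) - U x)"
    using integrable_translate(1)[OF U] U by simp
  have ik: "integrable lborel k" unfolding k_def using iI iD by simp
  have mult: "integrable lborel (\<lambda>x. f x * complex_of_real (box_bump n c d x))"
    if "integrable lborel f" for f n c d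
  proof (rule Bochner_Integration.integrable_bound[OF that])
    have "(\<lambda>x. complex_of_real (box_bump n c d x)) \<in> borel_measurable borel"
      by (rule test_function_bounded(1)[OF box_bump_test_function[where \<Omega> = UNIV]]) simp
    then show "(\<lambda>x. f x * complex_of_real (box_bump n c d x)) \<in> borel_measurable lborel"
      using that by (auto dest: borel_measurable_integrable)
    have "cmod (f x) * \<bar>box_bump n c d x\<bar> \<le> cmod (f x)" for x
      using box_bump_bounds[of n c d x] by (intro mult_left_le) auto
    then show "AE x in lborel. norm (f x * complex_of_real (box_bump n c d x)) \<le> norm (f x)"
      by (simp add: norm_mult)
  qed
  have bump0: "(\<integral>x. k x * complex_of_real (box_bump n c d x) \<partial>lborel) = 0"
    if cd: "cbox c d \<subseteq> cbox a b" for n c d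
  proof -
    have "(\<lambda>x. complex_of_real (box_bump n c d (x - s *\<^sub>R e))) \<in> test_functions \<Omega>"
      if "0 \<le> s" "s \<le> h" for s
      unfolding box_bump_translate
    proof (rule box_bump_test_function)
      have "cbox (c + s *\<^sub>R e) (d + s *\<^sub>R e) = (\<lambda>x. x + s *\<^sub>R e) ` cbox c d"
        using cbox_translation[of "s *\<^sub>R e" c d] by (simp add: add.commute)
      then show "cbox (c + s *\<^sub>R e) (d + s *\<^sub>R e) \<subseteq> \<Omega>"
        using sub[OF subsetD[OF cd]] that by auto
    qed
    from weak_difference_identity[OF U g weak this[unfolded e_def] h]
    have "(\<integral>x. (U (x + h *\<^sub>R e) - U x) * complex_of_real (box_bump n c d x) \<partial>lborel) =
        (\<integral>x. I x * complex_of_real (box_bump n c d x) \<partial>lborel)"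
      unfolding I_def e_def by simp
    then show ?thesis
      using mult[OF iD, of n c d] mult[OF iI, of n c d]
      unfolding k_def by (simp add: left_diff_distrib)
  qed
  have box0: "(\<integral>x. indicator (box c d) x *\<^sub>R k x \<partial>lborel) = 0" if cd: "cbox c d \<subseteq> cbox a b" for c d
  proof -
    have "(\<lambda>n. \<integral>x. k x * complex_of_real (box_bump n c d x) \<partial>lborel) \<longlonglongrightarrow>
        (\<integral>x. k x * complex_of_real (indicator (box c d) x) \<partial>lborel)"
    proof (rule integral_dominated_convergence[where w = "\<lambda>x. norm (k x)"])
      show "AE x in lborel. (\<lambda>n. k x * complex_of_real (box_bump n c d x)) \<longlonglongrightarrow>
          k x * complex_of_real (indicator (box c d) x)"
        by (intro AE_I2 tendsto_intros box_bump_tendsto)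
      have "cmod (k x) * \<bar>box_bump n c d x\<bar> \<le> cmod (k x)" for n x
        using box_bump_bounds[of n c d x] by (intro mult_left_le) auto
      then show "AE x in lborel. norm (k x * complex_of_real (box_bump n c d x)) \<le> norm (k x)" for n
        by (simp add: norm_mult)
    qed (use ik mult[OF ik] in \<open>auto dest: borel_measurable_integrable\<close>)
    then show ?thesis
      using bump0[OF cd] by (simp add: LIMSEQ_const_iff scaleR_conv_of_real mult.commute)
  qed
  have "AE x in lborel. indicator (box a b) x *\<^sub>R k x = 0"
  proof (rule AE_eq_0_if_box_integrals_0)
    show "integrable lborel (\<lambda>x. indicator (box a b) x *\<^sub>R k x)"
      using ik by (intro integrable_mult_indicator) auto
    fix c d :: "real^'n"
    \<comment> \<open>An arbitrary box is first cut down to \<open>box a b\<close>, because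
      \<open>box0\<close> only covers boxes whose closed version lies in
      \<open>cbox a b\<close>.\<close>
    obtain c' d' where cd': "box c d \<inter> box a b = box c' d'" by (simp add: box_Int_box)
    have eq: "(\<integral>x. indicator (box c d) x *\<^sub>R indicator (box a b) x *\<^sub>R k x \<partial>lborel) =
        (\<integral>x. indicator (box c' d') x *\<^sub>R k x \<partial>lborel)"
      unfolding cd'[symmetric] by (simp add: indicator_inter_arith)
    show "(\<integral>x. indicator (box c d) x *\<^sub>R indicator (box a b) x *\<^sub>R k x \<partial>lborel) = 0"
    \<comment> \<open>A nonempty open box has \<open>cbox c' d'\<close> as its closure; for an empty
      one \<open>cbox c' d'\<close> may still be nonempty and lie elsewhere, but the integral is
      trivially \<open>0\<close>.\<close>
    proof (cases "box c' d' = {}")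
      case False
      then have "cbox c' d' = closure (box c' d')" by (simp add: closure_box)
      also have "\<dots> \<subseteq> cbox a b"
        using cd' box_subset_cbox by (intro closure_minimal closed_cbox) blast
      finally show ?thesis using box0 eq by simp
    next
      case True
      show ?thesis unfolding eq True by simp
    qed
  qed
  then show ?thesis by eventually_elim (auto simp: k_def I_def)
qed

text \<open>The difference quotient minus \<open>g x\<close> is the average over \<open>s\<close> in
  \<open>{0..h}\<close> of \<open>g (x + s *\<^sub>R e) - g x\<close>, and the L1 norm of an average
  is at most any common bound of the L1 norms averaged.\<close>

lemma difference_quotient_L1_bound:
  fixes U g :: "real^'n \<Rightarrow> complex" and i :: 'n
  defines "e \<equiv> axis i 1"
  assumes U: "integrable lborel U" and g: "integrable lborel g"
    and weak: "\<And>\<psi>. \<psi> \<in> test_functions \<Omega> \<Longrightarrow>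
        (\<integral>x. U x * partial_deriv i \<psi> x \<partial>lborel) = - (\<integral>x. g x * \<psi> x \<partial>lborel)"
    and h: "h > 0"
    and sub: "\<And>x s. x \<in> cbox a b \<Longrightarrow> 0 \<le> s \<Longrightarrow> s \<le> h \<Longrightarrow> x + s *\<^sub>R e \<in> \<Omega>"
    and \<epsilon>: "\<And>s. 0 \<le> s \<Longrightarrow> s \<le> h \<Longrightarrow> (\<integral>x. norm (g (x + s *\<^sub>R e) - g x) \<partial>lborel) \<le> \<epsilon>"
  shows "(\<integral>x. norm (indicator (box a b) x *\<^sub>R ((U (x + h *\<^sub>R e) - U x) /\<^sub>R h - g x)) \<partial>lborel) \<le> \<epsilon>"
proof -
  let ?q = "\<lambda>s x. indicator {0..h} s *\<^sub>R (g (x + s *\<^sub>R e) - g x)"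
  let ?J = "\<lambda>x. \<integral>s. norm (?q s x) \<partial>lborel"
  have ls: "integrable (lborel \<Otimes>\<^sub>M lborel) (\<lambda>(s::real, x). indicator {0..h} s *\<^sub>R g (x + s *\<^sub>R e))"
    and ls0: "integrable (lborel \<Otimes>\<^sub>M lborel) (\<lambda>(s::real, x). indicator {0..h} s *\<^sub>R g x)"
    using integrable_line_shift[OF g, of h e] integrable_line_shift[OF g, of h 0] by simp_all
  have iq: "integrable (lborel \<Otimes>\<^sub>M lborel) (\<lambda>(s::real, x). ?q s x)"
    using Bochner_Integration.integrable_diff[OF ls ls0] by (simp add: case_prod_beta' scaleR_diff_right)
  then have inq: "integrable (lborel \<Otimes>\<^sub>M lborel) (\<lambda>(s::real, x). norm (?q s x))"
    using integrable_norm[OF iq] by (simp add: case_prod_beta')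
  have iU: "integrable lborel (\<lambda>x. norm (indicator (box a b) x *\<^sub>R ((U (x + h *\<^sub>R e) - U x) /\<^sub>R h - g x)))"
    using integrable_translate(1)[OF U, of "h *\<^sub>R e"] U g
    by (intro integrable_norm integrable_mult_indicator) auto
  have iJ: "integrable lborel ?J"
    using lborel_pair.integrable_snd[OF inq] .
  have diff: "AE x in lborel. x \<in> box a b \<longrightarrow>
      U (x + h *\<^sub>R e) - U x = (\<integral>s. indicator {0..h} s *\<^sub>R g (x + s *\<^sub>R e) \<partial>lborel)"
    unfolding e_def by (rule AE_difference_eq_line_integral[OF U g weak]) (use h sub in \<open>auto simp: e_def\<close>)
  \<comment> \<open>For almost every \<open>x\<close> the slice in \<open>s\<close> is integrable,
    so the integral of the difference splits into a line integral and
    \<open>h *\<^sub>R g x\<close>.\<close>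
  have "AE x in lborel. norm (indicator (box a b) x *\<^sub>R ((U (x + h *\<^sub>R e) - U x) /\<^sub>R h - g x)) \<le> ?J x / h"
    using diff lborel_pair.AE_integrable_snd[OF ls] lborel_pair.AE_integrable_snd[OF iq]
  proof eventually_elim
    case (elim x)
    show ?case
    proof (cases "x \<in> box a b")
      case True
      have "integrable lborel (\<lambda>s::real. indicator {0..h} s *\<^sub>R g x)"
        by (intro integrable_scaleR_left integrable_real_indicator) (auto simp: emeasure_lborel_Icc_eq)
      then have "(\<integral>s. ?q s x \<partial>lborel) =
          (\<integral>s. indicator {0..h} s *\<^sub>R g (x + s *\<^sub>R e) \<partial>lborel) - (\<integral>s. indicator {0..h} s *\<^sub>R g x \<partial>lborel)"
        using elim(2) by (simp add: scaleR_diff_right)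
      also have "\<dots> = (U (x + h *\<^sub>R e) - U x) - h *\<^sub>R g x"
        using elim(1) True h by simp
      finally have "(U (x + h *\<^sub>R e) - U x) /\<^sub>R h - g x = (\<integral>s. ?q s x \<partial>lborel) /\<^sub>R h"
        using h by (simp add: scaleR_diff_right)
      moreover have "norm (\<integral>s. ?q s x \<partial>lborel) \<le> ?J x" by (rule integral_norm_bound)
      ultimately show ?thesis using True h by (simp add: divide_simps)
    next
      case False
      moreover have "0 \<le> ?J x" by (rule integral_nonneg_AE) simp
      ultimately show ?thesis using h by simp
    qed
  qed
  then have "(\<integral>x. norm (indicator (box a b) x *\<^sub>R ((U (x + h *\<^sub>R e) - U x) /\<^sub>R h - g x)) \<partial>lborel)
      \<le> (\<integral>x. ?J x / h \<partial>lborel)"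
    using iJ by (intro integral_mono_AE iU) auto
  also have "\<dots> = (\<integral>x. ?J x \<partial>lborel) / h" by simp
  also have "(\<integral>x. ?J x \<partial>lborel) = (\<integral>s. (\<integral>x. norm (?q s x) \<partial>lborel) \<partial>lborel)"
    using lborel_pair.Fubini_integral[OF inq] .
  also have "\<dots> \<le> (\<integral>s. indicator {0..h} s * \<epsilon> \<partial>lborel)"
  proof (rule integral_mono)
    show "integrable lborel (\<lambda>s. \<integral>x. norm (?q s x) \<partial>lborel)"
      using lborel_pair.integrable_fst[OF inq] .
    show "integrable lborel (\<lambda>s. indicator {0..h} s * \<epsilon>)"
      by (intro integrable_mult_left integrable_real_indicator) (auto simp: emeasure_lborel_Icc_eq)
    show "(\<integral>x. norm (?q s x) \<partial>lborel) \<le> indicator {0..h} s * \<epsilon>" for s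
      using \<epsilon>[of s] by (cases "s \<in> {0..h}") auto
  qed
  also have "\<dots> = h * \<epsilon>" using h by simp
  finally show ?thesis using h by (simp add: divide_right_mono)
qed

lemma difference_quotient_L1_tendsto:
  fixes U g :: "real^'n \<Rightarrow> complex" and i :: 'n
  defines "e \<equiv> axis i 1"
  assumes U: "integrable lborel U" and g: "integrable lborel g"
    and weak: "\<And>\<psi>. \<psi> \<in> test_functions \<Omega> \<Longrightarrow>
        (\<integral>x. U x * partial_deriv i \<psi> x \<partial>lborel) = - (\<integral>x. g x * \<psi> x \<partial>lborel)"
    and \<Omega>: "open \<Omega>" "cbox a b \<subseteq> \<Omega>"
    and h: "\<And>n. h n > 0" "h \<longlonglongrightarrow> 0"
  shows "(\<lambda>n. \<integral>x. norm (indicator (box a b) x *\<^sub>R ((U (x + h n *\<^sub>R e) - U x) /\<^sub>R h n - g x)) \<partial>lborel) \<longlonglongrightarrow> 0"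
proof (rule tendstoI)
  fix \<epsilon> :: real assume "\<epsilon> > 0"
  have "L1_shift_continuous g" using g by (rule integrable_imp_L1_shift_continuous)
  then have "\<forall>\<^sub>F v in at 0. (\<integral>x. norm (g (x + v) - g x) \<partial>lborel) < \<epsilon> / 2"
    using \<open>\<epsilon> > 0\<close> unfolding L1_shift_continuous_def by (intro order_tendstoD(2)[of _ 0]) auto
  then obtain d where d: "d > 0" "\<And>v. v \<noteq> 0 \<Longrightarrow> dist v 0 < d \<Longrightarrow> (\<integral>x. norm (g (x + v) - g x) \<partial>lborel) < \<epsilon> / 2"
    by (auto simp: eventually_at)
  \<comment> \<open>The compact box has positive distance from the complement of \<Omega>, so short
    segments starting in it stay in \<Omega>.\<close>
  obtain d' where d': "d' > 0" "\<And>x y. x \<in> cbox a b \<Longrightarrow> y \<in> - \<Omega> \<Longrightarrow> d' \<le> dist x y"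
    using separate_compact_closed[of "cbox a b" "- \<Omega>"] \<Omega> by (auto simp: closed_Compl disjoint_eq_subset_Compl)
  have "\<forall>\<^sub>F n in sequentially. h n < min d d'"
    using h(2) d(1) d'(1) by (intro order_tendstoD(2)[of _ 0]) auto
  then show "\<forall>\<^sub>F n in sequentially. dist (\<integral>x. norm (indicator (box a b) x *\<^sub>R ((U (x + h n *\<^sub>R e) - U x) /\<^sub>R h n - g x)) \<partial>lborel) 0 < \<epsilon>"
  proof eventually_elim
    case (elim n)
    have ne: "norm e = 1" by (simp add: e_def)
    have "(\<integral>x. norm (indicator (box a b) x *\<^sub>R ((U (x + h n *\<^sub>R e) - U x) /\<^sub>R h n - g x)) \<partial>lborel) \<le> \<epsilon> / 2"
      unfolding e_def
    proof (rule difference_quotient_L1_bound[OF U g weak h(1)])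
      fix s assume s: "0 \<le> s" "s \<le> h n"
      show "(\<integral>x. norm (g (x + s *\<^sub>R axis i 1) - g x) \<partial>lborel) \<le> \<epsilon> / 2"
      \<comment> \<open>The choice of \<open>d\<close> controls nonzero shifts only; for
        \<open>s = 0\<close> the integral is \<open>0\<close>.\<close>
      proof (cases "s = 0")
        case False
        then show ?thesis using d(2)[of "s *\<^sub>R e"] s elim ne by (force simp: e_def)
      qed (use \<open>\<epsilon> > 0\<close> in simp)
      show "x + s *\<^sub>R axis i 1 \<in> \<Omega>" if "x \<in> cbox a b" for x
      proof (rule ccontr)
        assume "x + s *\<^sub>R axis i 1 \<notin> \<Omega>"
        then have "d' \<le> dist x (x + s *\<^sub>R e)" using d'(2)[OF that] by (simp add: e_def)
        also have "\<dots> = s" using ne s by (simp add: dist_norm)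
        finally show False using s elim by simp
      qed
    qed
    then show ?case using \<open>\<epsilon> > 0\<close> by (simp add: integral_nonneg_AE)
  qed
qed


section \<open>The chain rule for weak gradients\<close>

text \<open>A chain rule along sequences: in place of a differentiable curve it takes only
  convergent difference quotients, which is what L1 convergence provides almost everywhere along a
  subsequence.\<close>

lemma has_derivative_difference_quotient:
  fixes F :: "'a::real_normed_vector \<Rightarrow> 'b::real_normed_vector"
  assumes F: "(F has_derivative F') (at z)"
    and t: "\<And>n. t n > 0" "t \<longlonglongrightarrow> 0"
    and q: "(\<lambda>n. (y n - z) /\<^sub>R t n) \<longlonglongrightarrow> p"
  shows "(\<lambda>n. (F (y n) - F z) /\<^sub>R t n) \<longlonglongrightarrow> F' p"
proof -
  interpret F': bounded_linear F' using F by (rule has_derivative_bounded_linear)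
  \<comment> \<open>At \<open>v = z\<close> the quotient is \<open>0 / 0 = 0\<close>, so
    \<open>\<rho>\<close> is continuous at \<open>z\<close> with value \<open>0\<close> and may be
    evaluated along \<open>y\<close> even when \<open>y n = z\<close>.\<close>
  define \<rho> where "\<rho> v = norm (F v - F z - F' (v - z)) / norm (v - z)" for v
  have "(\<rho> \<longlongrightarrow> \<rho> z) (at z)"
    using F unfolding \<rho>_def has_derivative_iff_norm by simp
  then have \<rho>: "isCont \<rho> z" by (simp add: isCont_def)
  have tn: "t n \<noteq> 0" for n using t(1)[of n] by simp
  have "(\<lambda>n. z + t n *\<^sub>R ((y n - z) /\<^sub>R t n)) \<longlonglongrightarrow> z + 0 *\<^sub>R p"
    by (intro tendsto_intros t q)
  then have "y \<longlonglongrightarrow> z" using tn by simp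
  then have "(\<lambda>n. \<rho> (y n)) \<longlonglongrightarrow> \<rho> z" by (rule isCont_tendsto_compose[OF \<rho>])
  then have "(\<lambda>n. \<rho> (y n) * norm ((y n - z) /\<^sub>R t n)) \<longlonglongrightarrow> \<rho> z * norm p"
    by (intro tendsto_mult tendsto_norm q)
  moreover have "\<rho> (y n) * norm ((y n - z) /\<^sub>R t n) =
      norm ((F (y n) - F z) /\<^sub>R t n - F' ((y n - z) /\<^sub>R t n))" for n
  proof -
    have "(F (y n) - F z) /\<^sub>R t n - F' ((y n - z) /\<^sub>R t n) = (F (y n) - F z - F' (y n - z)) /\<^sub>R t n"
      unfolding F'.scaleR by (simp only: scaleR_diff_right)
    then show ?thesis
      using t(1)[of n] by (cases "y n = z") (auto simp: \<rho>_def divide_simps F'.zero)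
  qed
  ultimately have "(\<lambda>n. norm ((F (y n) - F z) /\<^sub>R t n - F' ((y n - z) /\<^sub>R t n))) \<longlonglongrightarrow> 0"
    by (simp add: \<rho>_def)
  then have "(\<lambda>n. (F (y n) - F z) /\<^sub>R t n - F' ((y n - z) /\<^sub>R t n)) \<longlonglongrightarrow> 0"
    by (simp only: tendsto_norm_zero_iff)
  from tendsto_add[OF this F'.tendsto[OF q]] show ?thesis by simp
qed

text \<open>The case \<open>U x \<noteq> 0\<close> is the sequential chain rule. On the zero set
  \<open>Z\<close> of \<open>U\<close> the function \<open>F\<close> may fail to be differentiable
  at the value of \<open>U\<close>; there, shift continuity of the indicator of \<open>Z\<close>
  shows that along a subsequence of steps almost every point of \<open>Z\<close> is eventually
  shifted into \<open>Z\<close>, which forces the difference quotients of \<open>U\<close> to be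
  \<open>0\<close>.\<close>

lemma AE_chain_rule_on_box:
  fixes U g k :: "real^'n \<Rightarrow> complex" and i :: 'n and F :: "complex \<Rightarrow> complex"
  assumes U: "integrable lborel U" and g: "integrable lborel g"
    and weak: "\<And>\<psi>. \<psi> \<in> test_functions \<Omega> \<Longrightarrow>
        (\<integral>x. U x * partial_deriv i \<psi> x \<partial>lborel) = - (\<integral>x. g x * \<psi> x \<partial>lborel)"
    and FU: "integrable lborel (\<lambda>x. F (U x))" and k: "integrable lborel k"
    and weak_F: "\<And>\<psi>. \<psi> \<in> test_functions \<Omega> \<Longrightarrow>
        (\<integral>x. F (U x) * partial_deriv i \<psi> x \<partial>lborel) = - (\<integral>x. k x * \<psi> x \<partial>lborel)"
    and F: "\<And>z. z \<noteq> 0 \<Longrightarrow> (F has_derivative F' z) (at z)"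
    and \<Omega>: "open \<Omega>" "cbox a b \<subseteq> \<Omega>"
  shows "AE x in lborel. x \<in> box a b \<longrightarrow> (if U x = 0 then g x = 0 else k x = F' (U x) (g x))"
proof -
  define e :: "real^'n" where "e = axis i 1"
  define h where "h n = inverse (real (Suc n))" for n
  have h: "h n > 0" "h \<longlonglongrightarrow> 0" for n
    unfolding h_def using LIMSEQ_inverse_real_of_nat by auto
  have [measurable]: "U \<in> borel_measurable borel" using U by (auto dest: borel_measurable_integrable)
  \<comment> \<open>Intersecting with the box gives \<open>Z\<close> finite measure, so its
    indicator is integrable.\<close>
  define Z where "Z = U -` {0} \<inter> box a b"
  have "Z \<in> sets borel" unfolding Z_def by measurable
  moreover have "emeasure lborel Z < \<infinity>"
    by (rule le_less_trans[OF emeasure_mono[of _ "cbox a b"]])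
      (auto simp: Z_def emeasure_lborel_cbox_eq intro: box_subset_cbox[THEN subsetD])
  ultimately have Z: "integrable lborel (indicator Z :: _ \<Rightarrow> real)" by simp
  define dU where "dU n x = indicator (box a b) x *\<^sub>R ((U (x + h n *\<^sub>R e) - U x) /\<^sub>R h n - g x)" for n x
  define dF where "dF n x = indicator (box a b) x *\<^sub>R ((F (U (x + h n *\<^sub>R e)) - F (U x)) /\<^sub>R h n - k x)" for n x
  define dZ where "dZ n x = (indicator Z (x + h n *\<^sub>R e) - indicator Z x :: real)" for n x
  have int: "integrable lborel (dU n)" "integrable lborel (dF n)" "integrable lborel (dZ n)" for n
    unfolding dU_def dF_def dZ_def
    using integrable_translate(1)[OF U, of "h n *\<^sub>R e"] integrable_translate(1)[OF FU, of "h n *\<^sub>R e"]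
      integrable_translate(1)[OF Z, of "h n *\<^sub>R e"] U g FU k Z
    by (auto intro!: integrable_mult_indicator)
  have he: "filterlim (\<lambda>n. h n *\<^sub>R e) (at 0) sequentially"
  proof (rule filterlim_atI)
    show "(\<lambda>n. h n *\<^sub>R e) \<longlonglongrightarrow> 0" using tendsto_scaleR[OF h(2) tendsto_const[of e]] by simp
    show "\<forall>\<^sub>F n in sequentially. h n *\<^sub>R e \<noteq> 0"
      using h(1) by (auto simp: e_def less_imp_neq[symmetric])
  qed
  have "L1_shift_continuous (indicator Z :: _ \<Rightarrow> real)" by (rule integrable_imp_L1_shift_continuous[OF Z])
  then have "(\<lambda>n. \<integral>x. norm (dZ n x) \<partial>lborel) \<longlonglongrightarrow> 0"
    unfolding L1_shift_continuous_def dZ_def by (rule filterlim_compose[OF _ he])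
  moreover have "(\<lambda>n. \<integral>x. norm (dU n x) \<partial>lborel) \<longlonglongrightarrow> 0"
    unfolding dU_def e_def by (rule difference_quotient_L1_tendsto[OF U g weak \<Omega> h])
  moreover have "(\<lambda>n. \<integral>x. norm (dF n x) \<partial>lborel) \<longlonglongrightarrow> 0"
    unfolding dF_def e_def by (rule difference_quotient_L1_tendsto[OF FU k weak_F \<Omega> h])
  \<comment> \<open>Adding the three norms yields a single subsequence \<open>r\<close> along which
    all three sequences converge almost everywhere.\<close>
  ultimately have "(\<lambda>n. (\<integral>x. norm (dU n x) \<partial>lborel) + (\<integral>x. norm (dF n x) \<partial>lborel) + (\<integral>x. norm (dZ n x) \<partial>lborel)) \<longlonglongrightarrow> 0 + 0 + 0"
    by (intro tendsto_add)
  then have lim: "(\<lambda>n. \<integral>x. norm (norm (dU n x) + norm (dF n x) + norm (dZ n x)) \<partial>lborel) \<longlonglongrightarrow> 0"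
    using int by simp
  have "integrable lborel (\<lambda>x. norm (dU n x) + norm (dF n x) + norm (dZ n x))" for n
    using int by simp
  from tendsto_L1_AE_subseq[OF this lim] obtain r :: "nat \<Rightarrow> nat" where r: "strict_mono r"
    "AE x in lborel. (\<lambda>n. norm (dU (r n) x) + norm (dF (r n) x) + norm (dZ (r n) x)) \<longlonglongrightarrow> 0"
    by blast
  define t where "t n = h (r n)" for n
  have t: "t n > 0" "t \<longlonglongrightarrow> 0" "(\<lambda>n. t n *\<^sub>R e) \<longlonglongrightarrow> 0" for n
    using h(1) LIMSEQ_subseq_LIMSEQ[OF h(2) r(1)] tendsto_scaleR[OF LIMSEQ_subseq_LIMSEQ[OF h(2) r(1)] tendsto_const[of e]]
    by (simp_all add: t_def[abs_def] o_def)
  show ?thesis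
    using r(2)
  proof eventually_elim
    case (elim x)
    have d0: "(\<lambda>n. dU (r n) x) \<longlonglongrightarrow> 0" "(\<lambda>n. dF (r n) x) \<longlonglongrightarrow> 0" "(\<lambda>n. dZ (r n) x) \<longlonglongrightarrow> 0"
      by (rule Lim_null_comparison[OF always_eventually elim]; simp)+
    show ?case
    proof (intro impI)
      assume x: "x \<in> box a b"
      have "(\<lambda>n. dU (r n) x + g x) \<longlonglongrightarrow> 0 + g x" "(\<lambda>n. dF (r n) x + k x) \<longlonglongrightarrow> 0 + k x"
        by (intro tendsto_intros d0)+
      then have qU: "(\<lambda>n. (U (x + t n *\<^sub>R e) - U x) /\<^sub>R t n) \<longlonglongrightarrow> g x"
        and qF: "(\<lambda>n. (F (U (x + t n *\<^sub>R e)) - F (U x)) /\<^sub>R t n) \<longlonglongrightarrow> k x"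
        using x by (simp_all add: dU_def dF_def t_def)
      show "if U x = 0 then g x = 0 else k x = F' (U x) (g x)"
      proof (cases "U x = 0")
        case True
        then have "x \<in> Z" using x by (simp add: Z_def)
        then have "(\<lambda>n. indicator Z (x + t n *\<^sub>R e) - (1::real)) \<longlonglongrightarrow> 0"
          using d0(3) by (simp add: dZ_def t_def)
        \<comment> \<open>an indicator converging to \<open>1\<close> is eventually \<open>1\<close>, so the shifted points stay in \<open>Z\<close>\<close>
        then have "\<forall>\<^sub>F n in sequentially. - 1 < indicator Z (x + t n *\<^sub>R e) - (1::real)"
          by (rule order_tendstoD) simp
        then have "\<forall>\<^sub>F n in sequentially. (U (x + t n *\<^sub>R e) - U x) /\<^sub>R t n = 0"
          by eventually_elim (use True in \<open>auto simp: Z_def split: split_indicator_asm\<close>)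
        then have "(\<lambda>n. (U (x + t n *\<^sub>R e) - U x) /\<^sub>R t n) \<longlonglongrightarrow> 0" by (rule tendsto_eventually)
        with True LIMSEQ_unique[OF qU] show ?thesis by simp
      next
        case False
        from has_derivative_difference_quotient[OF F[OF False] t(1,2) qU]
        have "(\<lambda>n. (F (U (x + t n *\<^sub>R e)) - F (U x)) /\<^sub>R t n) \<longlonglongrightarrow> F' (U x) (g x)" .
        with False LIMSEQ_unique[OF qF] show ?thesis by simp
      qed
    qed
  qed
qed

section \<open>From Lebesgue measurable functions on the domain to integrable Borel functions on the
  whole space\<close>

lemma borel_representative:
  fixes f :: "'a::euclidean_space \<Rightarrow> complex"
  assumes f: "integrable lebesgue f"
  obtains g where "integrable lborel g" "AE x in lborel. g x = f x"
proof -
  \<comment> \<open>The Borel version is obtained for real valued functions, hence the split into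
    real and imaginary parts.\<close>
  have m: "(\<lambda>x. Re (f x)) \<in> borel_measurable lebesgue" "(\<lambda>x. Im (f x)) \<in> borel_measurable lebesgue"
    using borel_measurable_integrable[OF f] by measurable
  obtain a where a: "a \<in> borel_measurable lborel" "AE x in lborel. Re (f x) = a x"
    using completion_ex_borel_measurable_real[OF m(1)] by auto
  obtain b where b: "b \<in> borel_measurable lborel" "AE x in lborel. Im (f x) = b x"
    using completion_ex_borel_measurable_real[OF m(2)] by auto
  define g where "g x = Complex (a x) (b x)" for x
  have g: "g = (\<lambda>x. complex_of_real (a x) + \<i> * complex_of_real (b x))"
    by (auto simp: g_def complex_eq_iff)
  have [measurable]: "g \<in> borel_measurable lborel" unfolding g using a(1) b(1) by measurable
  have ae: "AE x in lborel. g x = f x" using a(2) b(2) by eventually_elim (auto simp: g_def complex_eq_iff)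
  have "integrable lebesgue g"
    using f
  proof (rule Bochner_Integration.integrable_bound)
    show "AE x in lebesgue. norm (g x) \<le> norm (f x)"
      using AE_completion[OF ae] by eventually_elim simp
  qed (auto intro: measurable_completion)
  then have "integrable lborel g" by (simp add: integrable_completion)
  with ae that show thesis by blast
qed

lemma L2_integrable_on_bounded:
  fixes f :: "real^'n \<Rightarrow> 'b::euclidean_space"
  assumes f: "f \<in> L2 \<Omega>" and B: "B \<subseteq> \<Omega>" "open B" "bounded B" and \<Omega>: "open \<Omega>"
  shows "integrable lebesgue (\<lambda>x. indicator B x *\<^sub>R f x)"
proof -
  have [measurable]: "\<Omega> \<in> sets lebesgue" "B \<in> sets lebesgue" using \<Omega> B by auto
  have "integrable lebesgue (\<lambda>x. indicator \<Omega> x *\<^sub>R (norm (f x))\<^sup>2)"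
    using f by (simp add: L2_def integrable_restrict_space)
  moreover have "integrable lebesgue (indicator B :: _ \<Rightarrow> real)"
    using lmeasurable_open[OF B(3,2)] unfolding fmeasurable_def by (intro integrable_real_indicator) simp_all
  ultimately have "integrable lebesgue (\<lambda>x. indicator \<Omega> x *\<^sub>R (norm (f x))\<^sup>2 + indicator B x)"
    by (rule Bochner_Integration.integrable_add)
  then show ?thesis
  proof (rule Bochner_Integration.integrable_bound)
    have "(\<lambda>x. indicator \<Omega> x *\<^sub>R f x) \<in> borel_measurable lebesgue"
      using f by (simp add: L2_def borel_measurable_restrict_space_iff)
    then have "(\<lambda>x. indicator B x *\<^sub>R indicator \<Omega> x *\<^sub>R f x) \<in> borel_measurable lebesgue"
      by measurable
    also have "(\<lambda>x. indicator B x *\<^sub>R indicator \<Omega> x *\<^sub>R f x) = (\<lambda>x. indicator B x *\<^sub>R f x)"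
      using B(1) by (auto simp: fun_eq_iff indicator_def)
    finally show "(\<lambda>x. indicator B x *\<^sub>R f x) \<in> borel_measurable lebesgue" .
    \<comment> \<open>This follows from \<open>(norm (f x) - 1)^2 \<ge> 0\<close>; the constant
      \<open>1\<close> is integrable over the bounded set \<open>B\<close>.\<close>
    have "norm (f x) \<le> (norm (f x))\<^sup>2 + 1" for x
      using zero_le_power2[of "norm (f x) - 1"] by (simp add: power2_diff) (smt (verit) norm_ge_zero)
    then show "AE x in lebesgue. norm (indicator B x *\<^sub>R f x) \<le> norm (indicator \<Omega> x *\<^sub>R (norm (f x))\<^sup>2 + indicator B x)"
      using B(1) by (intro AE_I2) (auto simp: indicator_def)
  qed
qed

text \<open>Transfers integrals over \<Omega> to the Borel representative; only values on
  \<open>B\<close> count, because \<open>\<psi>\<close> vanishes elsewhere.\<close>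

lemma integral_representative:
  fixes f U \<psi> :: "real^'n \<Rightarrow> complex"
  assumes U: "integrable lborel U" "AE x in lborel. U x = indicator B x *\<^sub>R f x"
    and f: "integrable lebesgue (\<lambda>x. indicator B x *\<^sub>R f x)"
    and \<psi>: "\<psi> \<in> borel_measurable borel" "\<And>x. x \<notin> B \<Longrightarrow> \<psi> x = 0"
    and B: "B \<subseteq> \<Omega>" "open \<Omega>"
  shows "(\<integral>x. U x * \<psi> x \<partial>lborel) = (\<integral>x. f x * \<psi> x \<partial>lebesgue_on \<Omega>)"
proof -
  have [measurable]: "U \<in> borel_measurable lborel" using U(1) by (rule borel_measurable_integrable)
  have [measurable]: "\<psi> \<in> borel_measurable lborel" using \<psi>(1) by simp
  have m\<psi>: "\<psi> \<in> borel_measurable lebesgue" by (intro measurable_completion) simp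
  have mU: "U \<in> borel_measurable lebesgue" by (intro measurable_completion) simp
  have "(\<integral>x. U x * \<psi> x \<partial>lborel) = (\<integral>x. U x * \<psi> x \<partial>lebesgue)"
    by (rule integral_completion[symmetric]) measurable
  also have "\<dots> = (\<integral>x. (indicator B x *\<^sub>R f x) * \<psi> x \<partial>lebesgue)"
  proof (rule integral_cong_AE)
    show "AE x in lebesgue. U x * \<psi> x = (indicator B x *\<^sub>R f x) * \<psi> x"
      using AE_completion[OF U(2)] by eventually_elim simp
    show "(\<lambda>x. (indicator B x *\<^sub>R f x) * \<psi> x) \<in> borel_measurable lebesgue"
      using borel_measurable_integrable[OF f] m\<psi> by (intro borel_measurable_times)
    show "(\<lambda>x. U x * \<psi> x) \<in> borel_measurable lebesgue"
      using mU m\<psi> by (intro borel_measurable_times)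
  qed
  also have "\<dots> = (\<integral>x. indicator \<Omega> x *\<^sub>R (f x * \<psi> x) \<partial>lebesgue)"
    using B(1) \<psi>(2) by (intro Bochner_Integration.integral_cong) (auto simp: indicator_def)
  also have "\<dots> = (\<integral>x. f x * \<psi> x \<partial>lebesgue_on \<Omega>)"
    using B(2) by (subst integral_restrict_space) auto
  finally show ?thesis .
qed

lemma test_functions_mono: "B \<subseteq> \<Omega> \<Longrightarrow> test_functions B \<subseteq> test_functions \<Omega>"
  by (auto simp: test_functions_def)

text \<open>The sharp cut-off by \<open>indicator B\<close> does no harm: a test function supported
  in \<open>B\<close>, together with its derivatives, never sees the jump across the boundary of
  \<open>B\<close>.\<close>

lemma weak_gradient_localize:
  fixes u U g :: "real^'n \<Rightarrow> complex" and G :: "real^'n \<Rightarrow> complex^'n"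
  assumes uG: "u \<in> L2 \<Omega>" "G \<in> L2 \<Omega>" "is_weak_gradient \<Omega> u G"
    and B: "B \<subseteq> \<Omega>" "open B" "bounded B" and \<Omega>: "open \<Omega>"
    and U: "integrable lborel U" "AE x in lborel. U x = indicator B x *\<^sub>R u x"
    and g: "integrable lborel g" "AE x in lborel. g x = indicator B x *\<^sub>R (G x $ i)"
    and \<psi>: "\<psi> \<in> test_functions B"
  shows "(\<integral>x. U x * partial_deriv i \<psi> x \<partial>lborel) = - (\<integral>x. g x * \<psi> x \<partial>lborel)"
proof -
  have supp: "closure {x. \<psi> x \<noteq> 0} \<subseteq> B" using \<psi> by (simp add: test_functions_def)
  have \<psi>0: "\<psi> x = 0" if "x \<notin> B" for x using that supp closure_subset[of "{x. \<psi> x \<noteq> 0}"] by blast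
  have D0: "partial_deriv i \<psi> x = 0" if "x \<notin> B" for x
    using that supp by (intro partial_deriv_eq_0_outside_support) blast
  have iG: "integrable lebesgue (\<lambda>x. indicator B x *\<^sub>R (G x $ i))"
    using integrable_bounded_linear[OF bounded_linear_vec_nth[of i] L2_integrable_on_bounded[OF uG(2) B \<Omega>]]
    by simp
  have "(\<integral>x. U x * partial_deriv i \<psi> x \<partial>lborel) = (\<integral>x. u x * partial_deriv i \<psi> x \<partial>lebesgue_on \<Omega>)"
    using test_function_bounded(4)[OF \<psi>] D0
    by (intro integral_representative[OF U L2_integrable_on_bounded[OF uG(1) B \<Omega>] _ _ B(1) \<Omega>]
        borel_measurable_continuous_onI)
  also have "\<dots> = - (\<integral>x. G x $ i * \<psi> x \<partial>lebesgue_on \<Omega>)"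
    using uG(3) \<psi> test_functions_mono[OF B(1)] unfolding is_weak_gradient_def by blast
  also have "(\<integral>x. G x $ i * \<psi> x \<partial>lebesgue_on \<Omega>) = (\<integral>x. g x * \<psi> x \<partial>lborel)"
    using test_function_bounded(1)[OF \<psi>] \<psi>0
    by (intro integral_representative[OF g iG _ _ B(1) \<Omega>, symmetric])
  finally show ?thesis .
qed

text \<open>The rule is proved component by component on boxes whose closed version lies in
  \<Omega>, using cut-off Borel representatives; countably many such boxes cover \<Omega>.\<close>

lemma weak_gradient_chain_rule:
  fixes u :: "real^'n \<Rightarrow> complex" and G K :: "real^'n \<Rightarrow> complex^'n"
  assumes uG: "u \<in> L2 \<Omega>" "G \<in> L2 \<Omega>" "is_weak_gradient \<Omega> u G"
    and wK: "(\<lambda>x. F (u x)) \<in> L2 \<Omega>" "K \<in> L2 \<Omega>" "is_weak_gradient \<Omega> (\<lambda>x. F (u x)) K"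
    and F: "\<And>z. z \<noteq> 0 \<Longrightarrow> (F has_derivative F' z) (at z)" "F 0 = 0"
    and \<Omega>: "open \<Omega>"
  shows "AE x in lebesgue_on \<Omega>. if u x = 0 then G x = 0 else \<forall>i. K x $ i = F' (u x) (G x $ i)"
proof -
  \<comment> \<open>\<open>F\<close> may be discontinuous at \<open>0\<close>; continuity away from
    \<open>0\<close> together with \<open>F 0 = 0\<close> still makes it Borel.\<close>
  have "continuous_on (- {0}) F"
    using F(1) by (intro continuous_at_imp_continuous_on) (auto dest: has_derivative_continuous)
  from borel_measurable_continuous_on_indicator[OF _ this]
  have "(\<lambda>z. indicator (- {0}) z *\<^sub>R F z) \<in> borel_measurable borel" by simp
  moreover have "(\<lambda>z. indicator (- {0}) z *\<^sub>R F z) = F" using F(2) by (auto simp: indicator_def)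
  ultimately have Fm: "F \<in> borel_measurable borel" by simp
  let ?P = "\<lambda>x. if u x = 0 then G x = 0 else \<forall>i. K x $ i = F' (u x) (G x $ i)"
  have on_box: "AE x in lborel. x \<in> box a b \<longrightarrow> ?P x" if ab: "cbox a b \<subseteq> \<Omega>" for a b
  proof -
    obtain R where R: "cbox a b \<subseteq> ball 0 R" "R > 0"
      using bounded_subset_ballD[OF bounded_cbox] by blast
    \<comment> \<open>On a bounded neighbourhood of the closed box L2 functions are integrable, and
      test functions on it are test functions on \<Omega>.\<close>
    define B where "B = \<Omega> \<inter> ball 0 R"
    have B: "B \<subseteq> \<Omega>" "open B" "bounded B" "cbox a b \<subseteq> B"
      using \<Omega> ab R by (auto simp: B_def intro: bounded_subset[OF bounded_ball])
    obtain U where U: "integrable lborel U" "AE x in lborel. U x = indicator B x *\<^sub>R u x"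
      using borel_representative[OF L2_integrable_on_bounded[OF uG(1) B(1-3) \<Omega>]] by blast
    \<comment> \<open>\<open>F 0 = 0\<close> lets composition with \<open>F\<close> commute with the
      cut-off.\<close>
    have FU_eq: "AE x in lborel. F (U x) = indicator B x *\<^sub>R F (u x)"
      using U(2) by eventually_elim (auto simp: indicator_def F(2))
    \<comment> \<open>Integrability is inherited from the L2 assumption on
      \<open>F (u x)\<close>.\<close>
    have FU: "integrable lborel (\<lambda>x. F (U x))"
    proof -
      have m: "(\<lambda>x. F (U x)) \<in> borel_measurable lborel"
        using measurable_compose[OF borel_measurable_integrable[OF U(1)] Fm] .
      have "integrable lebesgue (\<lambda>x. F (U x))"
      proof (rule Bochner_Integration.integrable_bound[OF L2_integrable_on_bounded[OF wK(1) B(1-3) \<Omega>]])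
        show "AE x in lebesgue. norm (F (U x)) \<le> norm (indicator B x *\<^sub>R F (u x))"
          using AE_completion[OF FU_eq] by eventually_elim simp
      qed (rule measurable_completion[OF m])
      then show ?thesis by (simp add: integrable_completion[OF m])
    qed
    have "AE x in lborel. x \<in> box a b \<longrightarrow> (if u x = 0 then G x $ i = 0 else K x $ i = F' (u x) (G x $ i))" for i
    proof -
      have iG: "integrable lebesgue (\<lambda>x. indicator B x *\<^sub>R (G x $ i))"
        and iK: "integrable lebesgue (\<lambda>x. indicator B x *\<^sub>R (K x $ i))"
        using integrable_bounded_linear[OF bounded_linear_vec_nth[of i] L2_integrable_on_bounded[OF uG(2) B(1-3) \<Omega>]]
          integrable_bounded_linear[OF bounded_linear_vec_nth[of i] L2_integrable_on_bounded[OF wK(2) B(1-3) \<Omega>]]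
        by simp_all
      obtain g where g: "integrable lborel g" "AE x in lborel. g x = indicator B x *\<^sub>R (G x $ i)"
        using borel_representative[OF iG] by blast
      obtain k where k: "integrable lborel k" "AE x in lborel. k x = indicator B x *\<^sub>R (K x $ i)"
        using borel_representative[OF iK] by blast
      have "AE x in lborel. x \<in> box a b \<longrightarrow> (if U x = 0 then g x = 0 else k x = F' (U x) (g x))"
        by (rule AE_chain_rule_on_box[OF U(1) g(1) weak_gradient_localize[OF uG B(1-3) \<Omega> U g]
            FU k(1) weak_gradient_localize[OF wK B(1-3) \<Omega> FU FU_eq k] F(1) B(2,4)])
      then show ?thesis
        using U(2) g(2) k(2)
        by eventually_elim (use B(4) box_subset_cbox[of a b] in \<open>auto simp: indicator_def split: if_splits\<close>)
    qed
    then have "AE x in lborel. \<forall>i. x \<in> box a b \<longrightarrow> (if u x = 0 then G x $ i = 0 else K x $ i = F' (u x) (G x $ i))"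
      unfolding AE_all_countable by blast
    then show ?thesis by eventually_elim (auto simp: vec_eq_iff)
  qed
  define \<F> where "\<F> = {box a b |a b. cbox a b \<subseteq> \<Omega>}"
  \<comment> \<open>Only countably many exceptional null sets may be united, so a countable subcover
    is extracted.\<close>
  obtain \<F>' where \<F>': "\<F>' \<subseteq> \<F>" "countable \<F>'" "\<Union>\<F>' = \<Union>\<F>"
    using Lindelof[of \<F>] by (auto simp: \<F>_def open_box)
  have "\<Omega> \<subseteq> \<Union>\<F>"
  proof
    fix x assume "x \<in> \<Omega>"
    then obtain a b where "x \<in> box a b" "cbox a b \<subseteq> \<Omega>"
      using \<Omega> by (meson open_contains_cbox)
    then show "x \<in> \<Union>\<F>" by (auto simp: \<F>_def)
  qed
  have "AE x in lborel. \<forall>S\<in>\<F>'. x \<in> S \<longrightarrow> ?P x"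
  proof (rule AE_ball_countable'[OF _ \<F>'(2)])
    fix S assume "S \<in> \<F>'"
    then obtain a b where "S = box a b" "cbox a b \<subseteq> \<Omega>" using \<F>'(1) by (auto simp: \<F>_def)
    then show "AE x in lborel. x \<in> S \<longrightarrow> ?P x" using on_box by blast
  qed
  then have "AE x in lborel. x \<in> \<Omega> \<longrightarrow> ?P x"
    by eventually_elim (use \<open>\<Omega> \<subseteq> \<Union>\<F>\<close> \<F>'(3) in blast)
  then show ?thesis
    using \<Omega> by (subst AE_restrict_space_iff) (auto dest: AE_completion)
qed


section \<open>The pointwise inequality\<close>

lemma admissible_deriv:
  assumes "admissible \<phi>" "s > 0"
  shows "\<phi> s > 0" "(\<phi> has_real_derivative deriv \<phi> s) (at s)"
    and "((\<lambda>s. s * \<phi> s) has_real_derivative \<phi> s + s * deriv \<phi> s) (at s)" "\<phi> s + s * deriv \<phi> s > 0"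
proof -
  show "\<phi> s > 0" using assms by (auto simp: admissible_def)
  obtain D where "\<And>s. s > 0 \<Longrightarrow> (\<phi> has_vector_derivative D s) (at s)"
    using assms(1) by (auto simp: admissible_def C1_differentiable_on_def)
  then have "(\<phi> has_real_derivative D s) (at s)"
    using assms(2) by (simp add: has_real_derivative_iff_has_vector_derivative)
  then show d: "(\<phi> has_real_derivative deriv \<phi> s) (at s)"
    by (auto simp: DERIV_imp_deriv)
  then show d': "((\<lambda>s. s * \<phi> s) has_real_derivative \<phi> s + s * deriv \<phi> s) (at s)"
    by (auto intro!: derivative_eq_intros)
  have "deriv (\<lambda>s. s * \<phi> s) s > 0" using assms by (auto simp: admissible_def)
  then show "\<phi> s + s * deriv \<phi> s > 0" using DERIV_imp_deriv[OF d'] by simp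
qed

text \<open>Evaluating at \<open>t = s * sqrt (\<phi> s)\<close> makes the inverse function
  explicit: \<Lambda> is the logarithmic derivative of \<zeta> minus \<open>1\<close>, and by the
  inverse function rule the former equals \<open>?f s / (s * ?D s)\<close>.\<close>

lemma Lambda_eq:
  assumes \<phi>: "admissible \<phi>" and s: "s > 0"
  shows "Lambda \<phi> (s * sqrt (\<phi> s)) = 2 * \<phi> s / (2 * \<phi> s + s * deriv \<phi> s) - 1"
proof -
  let ?f = "\<lambda>s. s * sqrt (\<phi> s)"
  let ?D = "\<lambda>s. (2 * \<phi> s + s * deriv \<phi> s) / (2 * sqrt (\<phi> s))"
  have D: "(?f has_real_derivative ?D s) (at s)" "?D s > 0" if "s > 0" for s
  proof -
    note ad = admissible_deriv[OF \<phi> that]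
    show "(?f has_real_derivative ?D s) (at s)"
      using ad(1) by (auto intro!: derivative_eq_intros ad(2) simp: field_simps)
    \<comment> \<open>The numerator is the sum of \<open>\<phi> s\<close> and
      \<open>\<phi> s + s * deriv \<phi> s\<close>, both positive.\<close>
    show "?D s > 0" using ad(1,4) by simp
  qed
  have mono: "?f a < ?f b" if "0 < a" "a < b" for a b
  proof (rule DERIV_pos_imp_increasing[OF that(2)])
    fix x assume "a \<le> x"
    then show "\<exists>y. (?f has_real_derivative y) (at x) \<and> 0 < y" using D[of x] that(1) by auto
  qed
  have inj: "inj_on ?f {0<..}"
    by (rule linorder_inj_onI') (use mono in \<open>force\<close>)
  have inv: "zeta \<phi> (?f s) = s" if "s > 0" for s
    unfolding zeta_def using that by (intro the_inv_into_f_f[OF inj]) auto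
  have "(zeta \<phi> has_real_derivative inverse (?D s)) (at (?f s))"
    unfolding has_field_derivative_def
  proof (rule has_derivative_inverse_strong[where S = "{0<..}" and f = ?f])
    show "continuous_on {0<..} ?f"
      using D(1) by (intro continuous_at_imp_continuous_on) (auto dest: DERIV_isCont)
    show "(?f has_derivative (*) (?D s)) (at s)"
      using D(1)[OF s] by (simp only: has_field_derivative_def)
    have "?D s \<noteq> 0" using D(2)[OF s] by linarith
    then show "(*) (?D s) \<circ> (*) (inverse (?D s)) = id"
      by (simp only: fun_eq_iff o_def id_def mult.assoc[symmetric] right_inverse mult_1_left simp_thms)
  qed (use s inv in auto)
  have b: "\<phi> s > 0" "sqrt (\<phi> s) > 0" "sqrt (\<phi> s) * sqrt (\<phi> s) = \<phi> s" "2 * \<phi> s + s * deriv \<phi> s > 0"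
    using admissible_deriv[OF \<phi> s] by simp_all
  have "((\<lambda>t. zeta \<phi> t / t) has_real_derivative (inverse (?D s) * ?f s - s) / (?f s * ?f s)) (at (?f s))"
    using s b(1) by (auto intro!: derivative_eq_intros \<open>(zeta \<phi> has_real_derivative inverse (?D s)) (at (?f s))\<close> simp: inv)
  then have "deriv (Theta \<phi>) (?f s) = (inverse (?D s) * ?f s - s) / (?f s * ?f s)"
    unfolding Theta_def[abs_def] by (rule DERIV_imp_deriv)
  then have "Lambda \<phi> (?f s) = ?f s * ((inverse (?D s) * ?f s - s) / (?f s * ?f s)) / (s / ?f s)"
    by (simp add: Lambda_def Theta_def inv s)
  also have "\<dots> = (inverse (?D s) * ?f s - s) / s"
  proof -
    \<comment> \<open>Stated for arbitrary \<open>y\<close> and \<open>w\<close>, so that the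
      cancellation leaves the square root and \<open>?D s\<close> untouched.\<close>
    have "s * y * ((w * (s * y) - s) / (s * y * (s * y))) / (s / (s * y)) = (w * (s * y) - s) / s"
      if "y > 0" for w y :: real
      using s that by (simp add: field_simps)
    then show ?thesis using b(2) by blast
  qed
  also have "\<dots> = inverse (?D s) * sqrt (\<phi> s) - 1"
  proof -
    have "(w * (s * y) - s) / s = w * y - 1" for w y :: real using s by (simp add: field_simps)
    then show ?thesis by blast
  qed
  also have "inverse (?D s) * sqrt (\<phi> s) = 2 * \<phi> s / (2 * \<phi> s + s * deriv \<phi> s)"
    using b(3) by (simp add: mult.assoc)
  finally show ?thesis .
qed

text \<open>With \<open>s = cmod z\<close>, this derivative stretches by
  \<open>\<phi> s + s * d\<close> along \<open>sgn z\<close> and by \<open>\<phi> s\<close>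
  orthogonally to it; these two factors become \<open>\<alpha>\<close> and \<open>\<beta>\<close> in
  the final estimate.\<close>

lemma has_derivative_radial:
  fixes z :: complex
  assumes \<phi>: "(\<phi> has_real_derivative d) (at (cmod z))" and z: "z \<noteq> 0"
  shows "((\<lambda>z. \<phi> (cmod z) *\<^sub>R z) has_derivative
    (\<lambda>p. (d * (p \<bullet> sgn z)) *\<^sub>R z + \<phi> (cmod z) *\<^sub>R p)) (at z)"
proof -
  have "((\<lambda>z. \<phi> (cmod z)) has_derivative (\<lambda>p. d * (p \<bullet> sgn z))) (at z)"
    using has_derivative_compose[OF has_derivative_norm[OF z] \<phi>[unfolded has_field_derivative_def]] by simp
  from has_derivative_scaleR[OF this has_derivative_ident]
  show ?thesis by (simp add: add.commute)
qed

section \<open>Expansion of the sesquilinear form in real vectors\<close>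

lemma matrix_vector_inner: "(M *v v) \<bullet> w = (\<Sum>i\<in>UNIV. \<Sum>j\<in>UNIV. M $ i $ j * v $ j * w $ i)"
  for M :: "real^'n^'n"
  by (simp add: inner_vec_def matrix_vector_mult_def sum_distrib_right)

text \<open>The adjoint has imaginary entries \<open>- Im (A $ j $ i)\<close>; swapping the sums
  brings back \<open>A $ i $ j\<close>, as needed for a termwise comparison with the sesquilinear
  form.\<close>

lemma Im_adjoint_mat_inner:
  fixes A :: "complex^'n^'n"
  shows "(Im_mat (adjoint_mat A) *v v) \<bullet> w = - (\<Sum>i\<in>UNIV. \<Sum>j\<in>UNIV. Im (A $ i $ j) * v $ i * w $ j)"
proof -
  have "(Im_mat (adjoint_mat A) *v v) \<bullet> w = - (\<Sum>i\<in>UNIV. \<Sum>j\<in>UNIV. Im (A $ j $ i) * v $ j * w $ i)"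
    by (simp add: matrix_vector_inner Im_mat_def adjoint_mat_def sum_negf)
  also have "(\<Sum>i\<in>UNIV. \<Sum>j\<in>UNIV. Im (A $ j $ i) * v $ j * w $ i) = (\<Sum>i\<in>UNIV. \<Sum>j\<in>UNIV. Im (A $ i $ j) * v $ i * w $ j)"
    by (rule sum.swap)
  finally show ?thesis .
qed

text \<open>The unimodular \<open>\<sigma>\<close> cancels in \<open>p $ j * cnj (q $ i)\<close>,
  and the real part of each term splits into four products; the one containing
  \<open>a $ i * b $ j\<close> is the transposed term contributed by the adjoint.\<close>

lemma Re_cinner_polar:
  fixes A :: "complex^'n^'n" and p q :: "complex^'n" and a b :: "real^'n"
  assumes \<sigma>: "cmod \<sigma> = 1"
    and p: "\<And>j. p $ j = \<sigma> * Complex (a $ j) (b $ j)"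
    and q: "\<And>j. q $ j = \<sigma> * Complex (\<alpha> * a $ j) (\<beta> * b $ j)"
  shows "Re (cinner (A *v p) q) = \<alpha> * ((Re_mat A *v a) \<bullet> a) + \<beta> * ((Re_mat A *v b) \<bullet> b)
    + \<beta> * ((Im_mat A *v a) \<bullet> b) + \<alpha> * ((Im_mat (adjoint_mat A) *v a) \<bullet> b)"
proof -
  have \<sigma>\<sigma>: "\<sigma> * cnj \<sigma> = 1" using \<sigma> by (simp add: complex_norm_square[symmetric])
  have "(\<sigma> * x) * cnj (\<sigma> * y) = (\<sigma> * cnj \<sigma>) * (x * cnj y)" for x y by (simp add: algebra_simps)
  then have pq: "p $ j * cnj (q $ i) = Complex (a $ j) (b $ j) * cnj (Complex (\<alpha> * a $ i) (\<beta> * b $ i))" for i j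
    unfolding p q \<sigma>\<sigma> by simp
  have "cinner (A *v p) q = (\<Sum>i\<in>UNIV. \<Sum>j\<in>UNIV. A $ i $ j * (p $ j * cnj (q $ i)))"
    by (simp add: cinner_def matrix_vector_mult_def sum_distrib_right mult.assoc)
  then have "Re (cinner (A *v p) q) = (\<Sum>i\<in>UNIV. \<Sum>j\<in>UNIV. Re (A $ i $ j * (p $ j * cnj (q $ i))))"
    by simp
  also have "\<dots> = (\<Sum>i\<in>UNIV. \<Sum>j\<in>UNIV. \<alpha> * (Re (A $ i $ j) * a $ j * a $ i) + \<beta> * (Re (A $ i $ j) * b $ j * b $ i)
      + \<beta> * (Im (A $ i $ j) * a $ j * b $ i) - \<alpha> * (Im (A $ i $ j) * a $ i * b $ j))"
    unfolding pq by (intro sum.cong refl) (simp add: algebra_simps)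
  also have "\<dots> = \<alpha> * ((Re_mat A *v a) \<bullet> a) + \<beta> * ((Re_mat A *v b) \<bullet> b)
    + \<beta> * ((Im_mat A *v a) \<bullet> b) + \<alpha> * ((Im_mat (adjoint_mat A) *v a) \<bullet> b)"
    unfolding Im_adjoint_mat_inner
    by (simp add: matrix_vector_inner Re_mat_def Im_mat_def sum.distrib sum_subtractf sum_distrib_left)
  finally show ?thesis .
qed

lemma Re_cinner_nonneg:
  fixes A :: "complex^'n^'n" and p q :: "complex^'n"
  assumes \<phi>: "admissible \<phi>" and z: "z \<noteq> 0"
    and cond: "\<And>t (\<xi> :: real^'n) \<eta>. t > 0 \<Longrightarrow>
        (1 - (Lambda \<phi> t)\<^sup>2) * ((Re_mat A *v \<xi>) \<bullet> \<xi>) + (Re_mat A *v \<eta>) \<bullet> \<eta>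
        + (1 + Lambda \<phi> t) * ((Im_mat A *v \<xi>) \<bullet> \<eta>)
        + (1 - Lambda \<phi> t) * ((Im_mat (adjoint_mat A) *v \<xi>) \<bullet> \<eta>) \<ge> 0"
    and q: "\<And>j. q $ j = (deriv \<phi> (cmod z) * (p $ j \<bullet> sgn z)) *\<^sub>R z + \<phi> (cmod z) *\<^sub>R (p $ j)"
  shows "Re (cinner (A *v p) q) \<ge> 0"
proof -
  define s where "s = cmod z"
  have s: "s > 0" using z by (simp add: s_def)
  define \<beta> where "\<beta> = \<phi> s"
  define \<alpha> where "\<alpha> = \<phi> s + s * deriv \<phi> s"
  \<comment> \<open>If \<open>p\<close> is the gradient of a function with value \<open>z\<close> at
    the point, then \<open>a\<close> is the gradient of its modulus and \<open>b\<close> the modulus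
    times the gradient of its phase.\<close>
  define a where "a = (\<chi> j. Re (cnj (sgn z) * p $ j))"
  define b where "b = (\<chi> j. Im (cnj (sgn z) * p $ j))"
  have \<sigma>: "cmod (sgn z) = 1" using z by (simp add: norm_sgn)
  then have \<sigma>\<sigma>: "sgn z * cnj (sgn z) = 1" by (simp add: complex_norm_square[symmetric])
  have pj: "p $ j = sgn z * Complex (a $ j) (b $ j)" for j
  proof -
    have "Complex (a $ j) (b $ j) = cnj (sgn z) * p $ j" by (simp add: a_def b_def complex_eq_iff)
    then have "sgn z * Complex (a $ j) (b $ j) = (sgn z * cnj (sgn z)) * p $ j" by (simp only: mult.assoc)
    then show ?thesis using \<sigma>\<sigma> by simp
  qed
  have qj: "q $ j = sgn z * Complex (\<alpha> * a $ j) (\<beta> * b $ j)" for j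
  proof -
    have "p $ j \<bullet> sgn z = a $ j" by (simp add: a_def inner_complex_def algebra_simps)
    moreover have "z = sgn z * complex_of_real s"
      using z by (simp add: s_def sgn_eq)
    ultimately have "q $ j = (deriv \<phi> s * a $ j) *\<^sub>R (sgn z * complex_of_real s) + \<beta> *\<^sub>R (sgn z * Complex (a $ j) (b $ j))"
      using q[of j] pj[of j] by (simp add: s_def[symmetric] \<beta>_def)
    also have "\<dots> = sgn z * ((deriv \<phi> s * a $ j) *\<^sub>R complex_of_real s + \<beta> *\<^sub>R Complex (a $ j) (b $ j))"
      by (simp add: algebra_simps)
    also have "(deriv \<phi> s * a $ j) *\<^sub>R complex_of_real s + \<beta> *\<^sub>R Complex (a $ j) (b $ j) = Complex (\<alpha> * a $ j) (\<beta> * b $ j)"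
      by (simp add: complex_eq_iff \<alpha>_def \<beta>_def algebra_simps)
    finally show ?thesis .
  qed
  have pos: "\<beta> > 0" "\<alpha> > 0"
    using admissible_deriv[OF \<phi> s] by (simp_all add: \<alpha>_def \<beta>_def)
  define L where "L = Lambda \<phi> (s * sqrt \<beta>)"
  have "L = 2 * \<beta> / (\<alpha> + \<beta>) - 1"
    using Lambda_eq[OF \<phi> s] by (simp add: L_def \<alpha>_def \<beta>_def add_ac)
  then have L: "1 + L = 2 * \<beta> / (\<alpha> + \<beta>)" "1 - L = 2 * \<alpha> / (\<alpha> + \<beta>)"
    using pos by (simp_all add: field_simps)
  \<comment> \<open>the hypothesis at \<open>\<xi> = k a\<close>, \<open>\<eta> = r b\<close> has the coefficients \<open>\<alpha>, \<beta>, \<beta>, \<alpha>\<close>\<close>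
  define r where "r = sqrt \<beta>"
  have r: "r > 0" "r * r = \<beta>" using pos by (simp_all add: r_def)
  \<comment> \<open>The \<eta> term fixes \<open>r * r = \<beta>\<close>; \<open>k\<close> is then
    chosen so that \<open>k * r = (\<alpha> + \<beta>) / 2\<close>, the common factor that turns
    \<open>1 + L\<close> and \<open>1 - L\<close> into \<open>\<beta>\<close> and
    \<open>\<alpha>\<close>.\<close>
  define k where "k = r * (\<alpha> + \<beta>) / (2 * \<beta>)"
  have "k * r = r * r * (\<alpha> + \<beta>) / (2 * \<beta>)" by (simp add: k_def)
  then have kr: "k * r = (\<alpha> + \<beta>) / 2" using pos r by simp
  have k: "(1 + L) * (k * r) = \<beta>" "(1 - L) * (k * r) = \<alpha>"
    unfolding kr L using pos by simp_all
  \<comment> \<open>The remaining coefficient is the product of the two mixed ones divided by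
    \<open>r * r\<close>, that is \<open>\<beta> * \<alpha> / \<beta>\<close>.\<close>
  have "(1 - L\<^sup>2) * (k * k) = (1 + L) * (k * r) * ((1 - L) * (k * r)) / (r * r)"
    using r(1) by (simp add: field_simps power2_eq_square)
  also have "\<dots> = \<alpha>" using k r(2) pos by simp
  finally have k2: "(1 - L\<^sup>2) * (k * k) = \<alpha>" .
  have "0 \<le> (1 - L\<^sup>2) * ((Re_mat A *v (k *\<^sub>R a)) \<bullet> (k *\<^sub>R a)) + (Re_mat A *v (r *\<^sub>R b)) \<bullet> (r *\<^sub>R b)
      + (1 + L) * ((Im_mat A *v (k *\<^sub>R a)) \<bullet> (r *\<^sub>R b))
      + (1 - L) * ((Im_mat (adjoint_mat A) *v (k *\<^sub>R a)) \<bullet> (r *\<^sub>R b))"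
    unfolding L_def using s pos by (intro cond) simp
  also have "\<dots> = ((1 - L\<^sup>2) * (k * k)) * ((Re_mat A *v a) \<bullet> a) + (r * r) * ((Re_mat A *v b) \<bullet> b)
      + ((1 + L) * (k * r)) * ((Im_mat A *v a) \<bullet> b) + ((1 - L) * (k * r)) * ((Im_mat (adjoint_mat A) *v a) \<bullet> b)"
    by (simp add: matrix_vector_mult_scaleR algebra_simps)
  also have "\<dots> = Re (cinner (A *v p) q)"
    unfolding k k2 r(2) by (rule Re_cinner_polar[OF \<sigma> pj qj, symmetric])
  finally show ?thesis .
qed

section \<open>Dissipativity by integrating the pointwise inequality\<close>

theorem corollary2:
  fixes \<Omega> :: "(real^'n) set"
    and A :: "real^'n \<Rightarrow> complex^'n^'n"
    and \<phi> :: "real \<Rightarrow> real"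
  assumes domain: "open \<Omega>" "connected \<Omega>" "\<Omega> \<noteq> {}"
    and A_Linf: "Linf_matrix \<Omega> A"
    and phi: "admissible \<phi>"
    and cond: "AE x in lebesgue_on \<Omega>. \<forall>t>0. \<forall>\<xi> \<eta> :: real^'n.
        (1 - (Lambda \<phi> t)\<^sup>2) * ((Re_mat (A x) *v \<xi>) \<bullet> \<xi>)
        + (Re_mat (A x) *v \<eta>) \<bullet> \<eta>
        + (1 + Lambda \<phi> t) * ((Im_mat (A x) *v \<xi>) \<bullet> \<eta>)
        + (1 - Lambda \<phi> t) * ((Im_mat (adjoint_mat (A x)) *v \<xi>) \<bullet> \<eta>) \<ge> 0"
  shows "LPhi_dissipative \<Omega> A \<phi>"
  unfolding LPhi_dissipative_def
proof (intro ballI impI)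
  fix u assume "u \<in> H1_0 \<Omega>" "(\<lambda>x. \<phi> (cmod (u x)) *\<^sub>R u x) \<in> H1_0 \<Omega>"
  then have H1: "u \<in> H1 \<Omega>" "(\<lambda>x. \<phi> (cmod (u x)) *\<^sub>R u x) \<in> H1 \<Omega>" by (simp_all add: H1_0_def)
  define G where "G = weak_grad \<Omega> u"
  define K where "K = weak_grad \<Omega> (\<lambda>x. \<phi> (cmod (u x)) *\<^sub>R u x)"
  \<comment> \<open>Membership in \<open>H1\<close> guarantees that the choice behind
    \<open>weak_grad\<close> satisfies its specification.\<close>
  have wg: "weak_grad \<Omega> v \<in> L2 \<Omega> \<and> is_weak_gradient \<Omega> v (weak_grad \<Omega> v)" if "v \<in> H1 \<Omega>" for v
  proof -
    have "\<exists>G. G \<in> L2 \<Omega> \<and> is_weak_gradient \<Omega> v G" using that by (auto simp: H1_def)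
    then show ?thesis unfolding weak_grad_def by (rule someI_ex)
  qed
  have "AE x in lebesgue_on \<Omega>. if u x = 0 then G x = 0 else
      \<forall>i. K x $ i = (deriv \<phi> (cmod (u x)) * (G x $ i \<bullet> sgn (u x))) *\<^sub>R u x + \<phi> (cmod (u x)) *\<^sub>R (G x $ i)"
  \<comment> \<open>The factor \<open>z\<close> gives this \<open>F\<close> the required value
    \<open>0\<close> at \<open>0\<close>, whatever \<open>\<phi> 0\<close> may be.\<close>
  proof (rule weak_gradient_chain_rule[where F = "\<lambda>z. \<phi> (cmod z) *\<^sub>R z"])
    fix z :: complex assume "z \<noteq> 0"
    then show "((\<lambda>z. \<phi> (cmod z) *\<^sub>R z) has_derivative
        (\<lambda>p. (deriv \<phi> (cmod z) * (p \<bullet> sgn z)) *\<^sub>R z + \<phi> (cmod z) *\<^sub>R p)) (at z)"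
      by (intro has_derivative_radial admissible_deriv[OF phi]) simp_all
  qed (use H1 wg[OF H1(1)] wg[OF H1(2)] domain in \<open>auto simp: G_def K_def H1_def\<close>)
  with cond have AE: "AE x in lebesgue_on \<Omega>. 0 \<le> Re (cinner (A x *v G x) (K x))"
  proof eventually_elim
    case (elim x)
    show ?case
    proof (cases "u x = 0")
      case True
      with elim show ?thesis by (simp add: cinner_def)
    next
      case False
      with elim show ?thesis by (intro Re_cinner_nonneg[OF phi False]) auto
    qed
  qed
  show "0 \<le> Re (LINT x|lebesgue_on \<Omega>. cinner (A x *v weak_grad \<Omega> u x)
      (weak_grad \<Omega> (\<lambda>x. \<phi> (cmod (u x)) *\<^sub>R u x) x))"
  \<comment> \<open>A non-integrable function has Bochner integral \<open>0\<close> by convention,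
    so the value is nonnegative in both cases.\<close>
  proof (cases "integrable (lebesgue_on \<Omega>) (\<lambda>x. cinner (A x *v G x) (K x))")
    case True
    then have "Re (LINT x|lebesgue_on \<Omega>. cinner (A x *v G x) (K x)) =
        (LINT x|lebesgue_on \<Omega>. Re (cinner (A x *v G x) (K x)))"
      by simp
    with AE show ?thesis by (simp add: G_def K_def integral_nonneg_AE)
  next
    case False
    then show ?thesis by (simp add: not_integrable_integral_eq G_def K_def)
  qed
qed

end
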